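(* For every integer $k\ge1$, every real $p>0$ and every integer $n\ge1$, $$\gamma_k^{-}=F_k\!\left(p,j_{p-1,n}^{2}\right).$$ Moreover, as polynomials in $p,y$, $$\deg_yF_k(p,y)=1+\left\lfloor\frac{k-1}{2}\right\rfloor=\left\lfloor\frac{k+1}{2}\right\rfloor,\qquad \deg_pF_k(p,y)=\max\{1,k-1\}.$$ Consequently, for every integer $r\ge2$, every real $p>0$ and every integer $n\ge1$, $$\mathcal T_r^{-}(p,n)=\frac{F_{r-1}\!\left(p,j_{p-1,n}^{2}\right)}{\left(j_{p-1,n}^{2}\right)^r},$$ where the numerator polynomial $F_{r-1}(p,y)$ satisfies $\deg_yF_{r-1}=\left\lfloor\frac r2\right\rfloor$ and $\deg_pF_{r-1}=\max\{1,r-2\}$; equivalently to the former, the degree in $z$ of $F_{r-1}(p,z^2)$ (with $z$ standing for $j_{p-1,n}$) is $2\left\lfloor\frac r2\right\rfloor$, that is, $r$ if $r$ is even and $r-1$ if $r$ is odd.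
   Context: For real $\nu>-1$, $J_\nu$ is the Bessel function of the first kind of order $\nu$ and $j_{\nu,m}$ denotes its $m$th positive zero ($m\ge1$). For $p>0$ and integers $r,n\ge1$, $$\mathcal T_r^{-}(p,n)=\sum_{m\ge1}\frac{1}{\left(j_{p,m}^{2}-j_{p-1,n}^{2}\right)^r}.$$ Let $D_p(x)=\dfrac{J_{p+1}(\sqrt{x})}{2\sqrt{x}\,J_p(\sqrt{x})}=\sum_{m\ge1}\dfrac{1}{j_{p,m}^2-x}$, which is analytic near $x=j_{p-1,n}^2$, and for $k\ge0$ let $$\beta_k^{-}=\frac{D_p^{(k)}\left(j_{p-1,n}^2\right)}{k!}=\mathcal T_{k+1}^{-}(p,n),\qquad \gamma_k^{-}=\left(j_{p-1,n}^{2}\right)^{k+1}\beta_k^{-}.$$ The two-variable polynomials $E_k(p,y)$, $k\geq 1$, are defined by $E_1(p,y)=\frac14$ and, for $k\ge1$, $$E_{k+1}(p,y)=\frac{1}{k+1}\left[y\sum_{j=1}^{k-1}E_j(p,y)E_{k-j}(p,y)+y\sum_{j=1}^{k-2}E_j(p,y)E_{k-1-j}(p,y)-(k+p+1)E_k(p,y)\right],$$ where empty sums are zero, and $$F_k(p,y)=(-1)^k p+y\,E_k(-p,y),\qquad k\ge1.$$ Degrees in $p$ and $y$ refer to $F_k$ as a polynomial in the two indeterminates $p,y$. *)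

theory Defs
  imports
    "HOL-Analysis.Analysis"
    "HOL-Computational_Algebra.Polynomial"
begin

section \<open>Bessel functions of the first kind and their positive zeros\<close>

text \<open>Intended for \<open>x > 0\<close> and \<open>\<nu> > -1\<close> (at \<open>x = 0\<close> the convention \<open>0 powr a = 0\<close> gives the
  wrong value for \<open>\<nu> = 0\<close>).\<close>

definition bessel_J :: "real \<Rightarrow> real \<Rightarrow> real" where
  "bessel_J \<nu> x =
     (\<Sum>m. (- 1) ^ m / (fact m * Gamma (real m + \<nu> + 1)) * (x / 2) powr (2 * real m + \<nu>))"

text \<open>For \<open>m \<ge> 1\<close>, the \<open>m\<close>-th positive zero in increasing order, i.e. the positive zero \<open>x\<close>
  for which exactly \<open>m\<close> positive zeros are at most \<open>x\<close>.  The positive zeros of \<open>J\<^sub>\<nu>\<close> are simple,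
  so counting them without multiplicity is harmless.\<close>

definition bessel_zero :: "real \<Rightarrow> nat \<Rightarrow> real" where
  "bessel_zero \<nu> m =
     (THE x. 0 < x \<and> bessel_J \<nu> x = 0 \<and> card {z. 0 < z \<and> z \<le> x \<and> bessel_J \<nu> z = 0} = m)"

section \<open>The sums and the Taylor coefficients\<close>

definition T_minus :: "nat \<Rightarrow> real \<Rightarrow> nat \<Rightarrow> real" where
  "T_minus r p n =
     (\<Sum>m. 1 / ((bessel_zero p (Suc m))\<^sup>2 - (bessel_zero (p - 1) n)\<^sup>2) ^ r)"

definition D :: "real \<Rightarrow> real \<Rightarrow> real" where
  "D p x = bessel_J (p + 1) (sqrt x) / (2 * sqrt x * bessel_J p (sqrt x))"

definition beta_minus :: "real \<Rightarrow> nat \<Rightarrow> nat \<Rightarrow> real" where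
  "beta_minus p n k = (deriv ^^ k) (D p) ((bessel_zero (p - 1) n)\<^sup>2) / fact k"

definition gamma_minus :: "real \<Rightarrow> nat \<Rightarrow> nat \<Rightarrow> real" where
  "gamma_minus p n k = ((bessel_zero (p - 1) n)\<^sup>2) ^ (k + 1) * beta_minus p n k"

section \<open>The polynomials in two indeterminates\<close>

text \<open>Polynomials in \<open>p\<close> and \<open>y\<close> are elements of \<open>\<real>[p][y]\<close>: the outer indeterminate is \<open>y\<close>, the
  coefficients are polynomials in \<open>p\<close>.  Hence \<^const>\<open>degree\<close> is the degree in \<open>y\<close>.\<close>

abbreviation indet_p :: "real poly poly" where
  "indet_p \<equiv> [:[:0, 1:]:]"

abbreviation indet_y :: "real poly poly" where
  "indet_y \<equiv> [:0, 1:]"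

definition eval_py :: "real poly poly \<Rightarrow> real \<Rightarrow> real \<Rightarrow> real" where
  "eval_py P p y = poly (poly P [:y:]) p"

definition degree_p :: "real poly poly \<Rightarrow> nat" where
  "degree_p P = Max ((\<lambda>i. degree (coeff P i)) ` {..degree P})"

text \<open>The value at index 0 is a dummy; it is never used below.\<close>

fun E :: "nat \<Rightarrow> real poly poly" where
  "E 0 = 0"
| "E (Suc k) =
     (if k = 0 then [:[:1 / 4:]:]
      else smult [:1 / (real k + 1):]
        (indet_y * (\<Sum>j = 1..k - 1. E j * E (k - j))
         + indet_y * (\<Sum>j = 1..k - 2. E j * E (k - 1 - j))
         - (of_nat k + indet_p + 1) * E k))"

text \<open>The substitution \<open>p \<mapsto> -p\<close> acts on the coefficients.\<close>

definition F :: "nat \<Rightarrow> real poly poly" where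
  "F k = (- 1) ^ k * indet_p + indet_y * map_poly (\<lambda>c. pcompose c [:0, - 1:]) (E k)"

end

theory Submission
  imports Defs "HOL-Complex_Analysis.Complex_Analysis"
begin

text \<open>Put \<open>J\<^sub>\<nu>(x) = (x/2)\<^sup>\<nu> bes \<nu> (x\<^sup>2)\<close> with an entire function \<open>bes \<nu>\<close>.  Since \<open>bes \<nu>' = - bes (\<nu> + 1) / 4\<close>,
  the function \<open>D\<^sub>p\<close> is minus the logarithmic derivative of \<open>bes p\<close>, and Bessel's equation becomes the
  Riccati equation \<open>4 x D' = 4 x D\<^sup>2 - 4 (p + 1) D + 1\<close>.  Its Taylor coefficients at a point \<open>y\<close> with
  \<open>bes (p - 1) y = 0\<close>, where \<open>D y = p / y\<close>, satisfy a quadratic recurrence, and substituting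
  \<open>\<gamma>\<^sub>k = (-1)\<^sup>k p + y e\<^sub>k\<close> into it gives the recurrence of \<open>E\<^sub>k(-p, y)\<close>.

  The power sums are the derivatives of \<open>D\<^sub>p\<close> because \<open>bes p\<close> has exponential type and only positive
  simple zeros: dividing by the first \<open>N\<close> factors \<open>1 - z/j\<^sup>2\<close> and applying the Borel--Caratheodory
  inequality to the logarithm of the quotient shows that its derivatives of order at least two vanish
  in the limit.

  For the degrees, give \<open>p\<close> weight 1 and \<open>y\<close> weight 2: then \<open>E\<^sub>k\<close> has weight \<open>k - 1\<close>, and all monomials of
  top weight occur with coefficients of sign \<open>(-1)\<^sup>k\<^sup>-\<^sup>1\<close>.\<close>

section \<open>Partial fractions of logarithmic derivatives\<close>

text \<open>Points with real part below \<open>M\<close> are closer to 0 than to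
  \<open>2 * M\<close>, so u / (2 M - u) maps this half-plane into the unit disc and fixes 0.
  Schwarz's lemma bounds the image by |z| / R, at most 1/2, and solving for \<open>g z\<close> gives
  the bound.\<close>

lemma borel_caratheodory_half:
  assumes holg: "g holomorphic_on ball 0 R" and g0: "g 0 = 0" and "0 < R"
    and Re_less: "\<And>z. norm z < R \<Longrightarrow> Re (g z) < M"
    and z: "norm z \<le> R / 2"
  shows "norm (g z) \<le> 2 * M"
proof -
  have M: "0 < M" using Re_less[of 0] g0 \<open>0 < R\<close> by simp
  define w where "w = (\<lambda>\<zeta>. g (of_real R * \<zeta>) / (of_real (2 * M) - g (of_real R * \<zeta>)))"
  have img: "norm (of_real R * \<zeta>) < R" if "norm \<zeta> < 1" for \<zeta> :: complex
    using that \<open>0 < R\<close> by (simp add: norm_mult)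
  have less: "norm (g \<zeta>) < norm (of_real (2 * M) - g \<zeta>)" if "norm \<zeta> < R" for \<zeta>
  proof (rule power2_less_imp_less)
    have "Re (g \<zeta>) * M < M * M" using Re_less[OF that] M by simp
    thus "(norm (g \<zeta>))\<^sup>2 < (norm (of_real (2 * M) - g \<zeta>))\<^sup>2"
      unfolding cmod_power2 by (simp add: power2_eq_square algebra_simps)
  qed auto
  have nz: "of_real (2 * M) - g \<zeta> \<noteq> 0" if "norm \<zeta> < R" for \<zeta>
    using less[OF that] by auto
  have hol: "(\<lambda>\<zeta>. g (of_real R * \<zeta>)) holomorphic_on ball 0 1"
    using holomorphic_on_compose_gen[of "\<lambda>\<zeta>. of_real R * \<zeta>" "ball 0 1" g "ball 0 R"] holg img
    by (simp add: o_def image_subset_iff holomorphic_intros)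
  have "w holomorphic_on ball 0 1"
    unfolding w_def using nz img by (intro holomorphic_intros hol) auto
  moreover have "norm (w \<zeta>) < 1" if "norm \<zeta> < 1" for \<zeta>
    using less[OF img[OF that]] nz[OF img[OF that]]
    by (simp add: w_def norm_divide)
  moreover have "w 0 = 0" by (simp add: w_def g0)
  moreover have z1: "norm (z / of_real R) < 1" using z \<open>0 < R\<close> by (simp add: norm_divide)
  ultimately have "norm (w (z / of_real R)) \<le> norm (z / of_real R)"
    by (intro Schwarz_Lemma(1))
  also have "\<dots> \<le> 1 / 2" using z \<open>0 < R\<close> by (simp add: norm_divide)
  finally have "norm (g z / (of_real (2 * M) - g z)) \<le> 1 / 2"
    using \<open>0 < R\<close> by (simp add: w_def)
  moreover have "norm z < R" using z \<open>0 < R\<close> by linarith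
  ultimately have "2 * norm (g z) \<le> norm (of_real (2 * M) - g z)"
    using nz[of z] by (simp add: norm_divide)
  also have "\<dots> \<le> norm (of_real (2 * M) :: complex) + norm (g z)" by (rule norm_triangle_ineq4)
  also have "norm (of_real (2 * M) :: complex) = 2 * M" using M by (metis norm_of_real abs_of_pos mult_pos_pos zero_less_numeral)
  finally show ?thesis by simp
qed

text \<open>The zeros are divided out one at a time as removable singularities. The factors are
  normalised to 1 at the origin, so \<open>h 0 = f 0\<close>, which the later normalisation of the
  logarithm relies on.\<close>

lemma entire_divide_zeros:
  fixes f :: "complex \<Rightarrow> complex"
  assumes "finite A" and "f holomorphic_on UNIV" and "\<And>a. a \<in> A \<Longrightarrow> f a = 0" and "0 \<notin> A"
  shows "\<exists>h. h holomorphic_on UNIV \<and> (\<forall>z. f z = h z * (\<Prod>a\<in>A. 1 - z / a))"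
  using assms
proof (induction A rule: finite_induct)
  case empty
  thus ?case by auto
next
  case (insert a A)
  then obtain h where h: "h holomorphic_on UNIV" "\<And>z. f z = h z * (\<Prod>a\<in>A. 1 - z / a)"
    by auto
  have "a \<noteq> 0" using insert by auto
  \<comment> \<open>The factors already split off do not vanish at the new point \<open>a\<close>,
    so the zero of \<open>f\<close> there is inherited by \<open>h\<close>.\<close>
  have "(\<Prod>b\<in>A. 1 - a / b) \<noteq> 0"
    using insert by (auto simp: prod_zero_iff)
  with h(2)[of a] insert.prems(2)[of a] have ha: "h a = 0" by auto
  define k where "k = (\<lambda>z. if z = a then deriv h a else (h z - h a) / (z - a))"
  have k: "k holomorphic_on UNIV"
    unfolding k_def using h(1) by (intro pole_lemma_open) auto
  have eq: "h z = - a * k z * (1 - z / a)" for z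
  proof (cases "z = a")
    case False
    with \<open>a \<noteq> 0\<close> show ?thesis
      unfolding k_def by (simp add: ha divide_simps) (simp add: algebra_simps)
  qed (use ha \<open>a \<noteq> 0\<close> in simp)
  show ?case
  proof (intro exI[of _ "\<lambda>z. - a * k z"] conjI allI)
    show "(\<lambda>z. - a * k z) holomorphic_on UNIV" by (intro holomorphic_intros k)
    show "f z = - a * k z * (\<Prod>a\<in>insert a A. 1 - z / a)" for z
      using insert.hyps eq[of z] h(2)[of z] by simp
  qed
qed

lemma higher_deriv_inverse_linear:
  fixes a z :: complex
  assumes "z \<noteq> a"
  shows "(deriv ^^ k) (\<lambda>z. 1 / (z - a)) z = - fact k / (a - z) ^ Suc k"
  using assms
proof (induction k arbitrary: z)
  case 0
  thus ?case by (simp add: divide_simps)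
next
  case (Suc k)
  \<comment> \<open>The induction hypothesis is needed on a whole neighbourhood of \<open>z\<close>
    before it can be differentiated.\<close>
  have "eventually (\<lambda>w. w \<in> - {a}) (nhds z)"
    using Suc.prems by (intro eventually_nhds_in_open) auto
  hence "eventually (\<lambda>w. (deriv ^^ k) (\<lambda>z. 1 / (z - a)) w = - fact k / (a - w) ^ Suc k) (nhds z)"
    by eventually_elim (use Suc.IH in auto)
  hence "(deriv ^^ Suc k) (\<lambda>z. 1 / (z - a)) z = deriv (\<lambda>w. - fact k / (a - w) ^ Suc k) z"
    by (simp add: deriv_cong_ev)
  also have "\<dots> = - fact (Suc k) / (a - z) ^ Suc (Suc k)"
  proof (rule DERIV_imp_deriv)
    have "a - z \<noteq> 0" using Suc.prems by auto
    hence "(0 * (a - z) ^ Suc k - - fact k * (of_nat (Suc k) * ((0 - 1) * (a - z) ^ (Suc k - Suc 0))))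
        / ((a - z) ^ Suc k * (a - z) ^ Suc k) = - fact (Suc k) / (a - z) ^ Suc (Suc k)"
      unfolding fact_Suc by (simp add: divide_simps del: of_nat_Suc)
    thus "((\<lambda>w. - fact k / (a - w) ^ Suc k) has_field_derivative
        - fact (Suc k) / (a - z) ^ Suc (Suc k)) (at z)"
      using \<open>a - z \<noteq> 0\<close> by (auto intro!: derivative_eq_intros simp del: power_Suc fact_Suc of_nat_Suc)
  qed
  finally show ?case .
qed

lemma higher_deriv_sum:
  assumes "finite B" "\<And>b. b \<in> B \<Longrightarrow> f b holomorphic_on S" "open S" "z \<in> S"
  shows "(deriv ^^ k) (\<lambda>z. \<Sum>b\<in>B. f b z) z = (\<Sum>b\<in>B. (deriv ^^ k) (f b) z)"
  using assms(1,2)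
proof (induction B rule: finite_induct)
  case empty
  show ?case by (cases k) (simp_all add: higher_deriv_const del: funpow.simps)
next
  case (insert b B)
  have "(deriv ^^ k) (\<lambda>z. f b z + (\<Sum>b\<in>B. f b z)) z = (deriv ^^ k) (f b) z + (deriv ^^ k) (\<lambda>z. \<Sum>b\<in>B. f b z) z"
    using insert.prems by (intro higher_deriv_add[OF _ _ assms(3,4)] holomorphic_on_sum) auto
  thus ?case using insert by simp
qed

text \<open>Exponential type makes the logarithm of \<open>f\<close>, divided by its first
  \<open>N\<close> factors, of size O(R) on a disc of radius comparable to R = |a N|. By Cauchy's
  inequality its derivative of order k + 1 at \<open>x\<close> is O(R^(-k)), which tends to 0 once
  \<open>k \<ge> 1\<close>. An exponential factor of \<open>f\<close> could still contribute for k =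
  0.\<close>

lemma partial_fractions_of_logderiv:
  fixes f :: "complex \<Rightarrow> complex" and a :: "nat \<Rightarrow> complex"
  assumes holf: "f holomorphic_on UNIV" and "f 0 \<noteq> 0"
    and zeros: "{z. f z = 0} = range a" and "inj a"
    and simple: "\<And>m. deriv f (a m) \<noteq> 0"
    and incr: "incseq (\<lambda>m. norm (a m))" and lim: "filterlim (\<lambda>m. norm (a m)) at_top sequentially"
    and growth: "\<And>z. norm (f z) \<le> K * exp (c * norm z)" and "0 \<le> c"
    and "f x \<noteq> 0" and "k \<ge> 1"
  shows "(\<lambda>m. 1 / (a m - x) ^ Suc k) sums (- (deriv ^^ k) (\<lambda>z. deriv f z / f z) x / fact k)"
proof -
  define L where "L = (\<lambda>z. deriv f z / f z)"
  \<comment> \<open>The absolute value keeps \<open>A\<close> nonnegative; the summand 1 makes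
    \<open>Re (G z) < M\<close> strict below.\<close>
  define A where "A = \<bar>ln (K / norm (f 0))\<bar> + 1"
  \<comment> \<open>Collected from the final estimate: 2 from Borel-Caratheodory,
    \<open>8 ^ Suc k\<close> from the Cauchy radius R/8, and 1 + k from the quotient of
    factorials.\<close>
  define C where "C = 2 * (A + 2 * c) * 8 ^ Suc k * (1 + real k)"
  have a_nz: "a m \<noteq> 0" for m
    using zeros \<open>f 0 \<noteq> 0\<close> by (metis (mono_tags) mem_Collect_eq rangeI)
  have f_a: "f (a m) = 0" for m
    using zeros by blast
  have "0 < norm (f 0)" using \<open>f 0 \<noteq> 0\<close> by simp
  also have "\<dots> \<le> K" using growth[of 0] by simp
  finally have "0 < K" .
  \<comment> \<open>The condition on \<open>N\<close>, which holds eventually by \<open>lim\<close>,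
    makes R at least 1 and puts \<open>x\<close> into the disc of radius R/4.\<close>
  have bound: "norm ((\<Sum>m<N. 1 / (a m - x) ^ Suc k) - (- (deriv ^^ k) L x / fact k)) \<le> C * inverse (norm (a N))"
    if large: "norm (a N) \<ge> 1 + 4 * norm x" for N
  proof -
    define R where "R = norm (a N)"
    define M where "M = A + 2 * c * R"
    define P where "P = (\<lambda>z. \<Prod>b\<in>a ` {..<N}. 1 - z / b)"
    have "1 \<le> R" "norm x \<le> R / 4" using large norm_ge_zero[of x] unfolding R_def by linarith+
    hence "0 < R" by linarith
    have P_nz: "P z \<noteq> 0" if "f z \<noteq> 0" for z
      using that zeros a_nz by (auto simp: P_def prod_zero_iff)
    have "finite (a ` {..<N})" "0 \<notin> a ` {..<N}" using a_nz by auto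
    moreover have "f b = 0" if "b \<in> a ` {..<N}" for b using that zeros by auto
    ultimately obtain h where h: "h holomorphic_on UNIV" "\<And>z. f z = h z * P z"
      using entire_divide_zeros[OF _ holf, of "a ` {..<N}"] unfolding P_def by blast
    have derP: "(P has_field_derivative deriv P z) (at z)" for z
      unfolding P_def by (intro holomorphic_derivI[of _ UNIV] holomorphic_intros) (use a_nz in auto)
    have derh: "(h has_field_derivative deriv h z) (at z)" for z
      by (intro holomorphic_derivI[of _ UNIV] h) auto
    have derf: "deriv f z = deriv h z * P z + h z * deriv P z" for z
    proof -
      have "f = (\<lambda>z. h z * P z)" using h(2) by blast
      thus ?thesis using DERIV_imp_deriv[OF DERIV_mult[OF derh[of z] derP[of z]]] by (simp add: algebra_simps)
    qed
    \<comment> \<open>A zero inside the disc is some \<open>a m\<close> with \<open>m < N\<close>,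
      whose factor was divided out; if \<open>h\<close> vanished there too, \<open>f\<close> would
      have a multiple zero.\<close>
    have h_nz: "h z \<noteq> 0" if "norm z < R" for z
    proof
      assume "h z = 0"
      hence "f z = 0" using h(2) by simp
      then obtain m where m: "z = a m" using zeros by blast
      have "m < N" using that incr m unfolding R_def by (metis incseqD linorder_not_less)
      hence "P z = 0" unfolding P_def m using a_nz by (intro prod_zero) auto
      with \<open>h z = 0\<close> have "deriv f z = 0" by (simp add: derf)
      with simple m show False by simp
    qed
    \<comment> \<open>On the circle of radius 2R each factor has modulus at least 1, because |b| is
      at most R; hence |h| is at most |f| there, and the maximum principle carries the bound
      inside.\<close>
    have hbd: "norm (h z) \<le> K * exp (c * (2 * R))" if "norm z < R" for z
    proof (rule maximum_modulus_frontier[of h "ball 0 (2 * R)"])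
      show "h holomorphic_on interior (ball 0 (2 * R))" using h(1) holomorphic_on_subset by blast
      show "continuous_on (closure (ball 0 (2 * R))) h"
        using h(1) holomorphic_on_imp_continuous_on continuous_on_subset by blast
      show "z \<in> ball 0 (2 * R)" using that \<open>0 < R\<close> by simp
      show "norm (h w) \<le> K * exp (c * (2 * R))" if "w \<in> frontier (ball 0 (2 * R))" for w
      proof -
        have w: "norm w = 2 * R" using that \<open>0 < R\<close> by (simp add: frontier_ball)
        have "1 \<le> norm (1 - w / b)" if "b \<in> a ` {..<N}" for b
        proof -
          have "b \<noteq> 0" "norm b \<le> R" using that a_nz incr unfolding R_def by (auto simp: incseq_def)
          hence "2 \<le> norm (w / b)" using w by (simp add: norm_divide field_simps)
          also have "norm (w / b) \<le> norm (1 - w / b) + 1"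
            by (metis norm_triangle_sub norm_minus_commute norm_one add.commute)
          finally show ?thesis by simp
        qed
        hence "1 \<le> norm (P w)" unfolding P_def prod_norm[symmetric] by (intro prod_ge_1)
        hence "norm (h w) \<le> norm (f w)" unfolding h(2) norm_mult
          by (simp add: mult_le_cancel_left1)
        also have "\<dots> \<le> K * exp (c * (2 * R))" using growth[of w] w by simp
        finally show ?thesis .
      qed
    qed simp
    obtain g where g: "g holomorphic_on ball 0 R" "\<And>z. z \<in> ball 0 R \<Longrightarrow> exp (g z) = h z"
      using holomorphic_logarithm_exists[of "ball 0 R" h 0] h(1) h_nz \<open>0 < R\<close>
      by (metis UNIV_I centre_in_ball convex_ball holomorphic_on_subset mem_ball_0 open_ball subsetI)
    define G where "G = (\<lambda>z. g z - g 0)"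
    have holG: "G holomorphic_on ball 0 R" unfolding G_def by (intro holomorphic_intros g)
    have ReG: "Re (G z) < M" if z: "norm z < R" for z
    proof -
      have "norm (P 0) = 1" by (simp add: P_def)
      hence "norm (h 0) = norm (f 0)" using h(2)[of 0] by (simp add: norm_mult)
      have "exp (Re (G z)) = norm (exp (g z)) / norm (exp (g 0))"
        by (simp add: G_def exp_diff norm_divide)
      also have "\<dots> = norm (h z) / norm (f 0)"
        using g(2)[of z] g(2)[of 0] z \<open>0 < R\<close> \<open>norm (h 0) = norm (f 0)\<close> by simp
      also have "\<dots> \<le> K * exp (c * (2 * R)) / norm (f 0)"
        using hbd[OF z] by (intro divide_right_mono) auto
      also have "\<dots> = exp (ln (K / norm (f 0)) + 2 * c * R)"
        using \<open>0 < K\<close> \<open>f 0 \<noteq> 0\<close> by (simp add: exp_add algebra_simps)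
      finally have "Re (G z) \<le> ln (K / norm (f 0)) + 2 * c * R" by simp
      thus ?thesis unfolding M_def A_def by linarith
    qed
    have Gbd: "norm (G z) \<le> 2 * M" if "norm z \<le> R / 2" for z
      by (rule borel_caratheodory_half[OF holG _ \<open>0 < R\<close> ReG that]) (simp_all add: G_def)
    \<comment> \<open>R/4 + R/8 is less than R/2, so the Cauchy disc around \<open>x\<close> lies
      where \<open>Gbd\<close> applies.\<close>
    have sub: "cball x (R / 8) \<subseteq> cball 0 (R / 2)"
      using \<open>norm x \<le> R / 4\<close> \<open>0 < R\<close> by (intro cball_subset_cball_iff[THEN iffD2]) simp
    have sub': "cball 0 (R / 2) \<subseteq> ball (0::complex) R"
      using \<open>0 < R\<close> by auto
    have Gder: "norm ((deriv ^^ Suc k) G x) \<le> fact (Suc k) * (2 * M) / (R / 8) ^ Suc k"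
    proof (rule Cauchy_inequality)
      show "G holomorphic_on ball x (R / 8)"
        using holG sub sub' ball_subset_cball by (metis holomorphic_on_subset subset_trans)
      show "continuous_on (cball x (R / 8)) G"
        using holG sub sub' by (metis holomorphic_on_imp_continuous_on continuous_on_subset subset_trans)
      show "norm (G z) \<le> 2 * M" if "norm (x - z) = R / 8" for z
        using Gbd sub that by (auto simp: subset_iff dist_norm)
    qed (use \<open>0 < R\<close> in simp)
    define S where "S = ball 0 R \<inter> {z. f z \<noteq> 0}"
    have "continuous_on UNIV f" using holf holomorphic_on_imp_continuous_on by blast
    hence "open S" unfolding S_def
      by (intro open_Int open_Collect_neq) auto
    have "x \<in> S" using \<open>f x \<noteq> 0\<close> \<open>norm x \<le> R / 4\<close> \<open>0 < R\<close> by (auto simp: S_def)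
    have derG: "deriv G z = deriv h z / h z" if "norm z < R" for z
    proof -
      have "(g has_field_derivative deriv g z) (at z)"
        using that by (intro holomorphic_derivI[OF g(1)]) auto
      hence "((\<lambda>w. exp (g w)) has_field_derivative h z * deriv g z) (at z)"
        using g(2)[of z] that by (auto intro!: derivative_eq_intros)
      hence "(h has_field_derivative h z * deriv g z) (at z)"
        by (rule has_field_derivative_transform_within_open[where S = "ball 0 R"]) (use that g(2) in auto)
      hence "deriv h z = h z * deriv g z" by (rule DERIV_imp_deriv)
      moreover have "deriv G z = deriv g z"
        using \<open>(g has_field_derivative deriv g z) (at z)\<close> unfolding G_def
        by (intro DERIV_imp_deriv) (auto intro!: derivative_eq_intros)
      ultimately show ?thesis using h_nz[OF that] by simp
    qed
    have L_eq: "L z = deriv G z + (\<Sum>b\<in>a ` {..<N}. 1 / (z - b))" if "z \<in> S" for z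
    proof -
      have z: "norm z < R" "f z \<noteq> 0" using that by (auto simp: S_def)
      have nz: "b \<noteq> 0" "z - b \<noteq> 0" "1 - z / b \<noteq> 0" if b: "b \<in> a ` {..<N}" for b
      proof -
        obtain m where "b = a m" using b by blast
        thus "b \<noteq> 0" "z - b \<noteq> 0" using a_nz f_a[of m] z(2) by auto
        thus "1 - z / b \<noteq> 0" by simp
      qed
      have "deriv P z = P z * (\<Sum>b\<in>a ` {..<N}. (- 1 / b) / (1 - z / b))"
        unfolding P_def
      proof (intro DERIV_imp_deriv has_field_derivative_prod')
        show "1 - z / b \<noteq> 0" if "b \<in> a ` {..<N}" for b
          using nz(3)[OF that] .
        show "((\<lambda>w. 1 - w / b) has_field_derivative - 1 / b) (at z)" if "b \<in> a ` {..<N}" for b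
          using nz(1)[OF that] by (auto intro!: derivative_eq_intros)
      qed
      also have "(\<Sum>b\<in>a ` {..<N}. (- 1 / b) / (1 - z / b)) = (\<Sum>b\<in>a ` {..<N}. 1 / (z - b))"
      proof (intro sum.cong refl)
        fix b assume b: "b \<in> a ` {..<N}"
        have "1 - z / b = - ((z - b) / b)" using nz(1)[OF b] by (simp add: diff_divide_distrib)
        thus "(- 1 / b) / (1 - z / b) = 1 / (z - b)" using nz(1,2)[OF b] by simp
      qed
      finally have "deriv P z / P z = (\<Sum>b\<in>a ` {..<N}. 1 / (z - b))" using P_nz z by simp
      moreover have "L z = deriv h z / h z + deriv P z / P z"
        unfolding L_def derf h(2)[of z] using P_nz z h_nz by (simp add: add_divide_distrib)
      ultimately show ?thesis using derG z by simp
    qed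
    have holG': "deriv G holomorphic_on S"
      by (rule holomorphic_on_subset[OF holomorphic_deriv[OF holG]]) (auto simp: S_def)
    have holinv: "(\<lambda>z. 1 / (z - b)) holomorphic_on S" if "b \<in> a ` {..<N}" for b
      using that zeros by (intro holomorphic_intros) (auto simp: S_def)
    have holsum: "(\<lambda>z. \<Sum>b\<in>a ` {..<N}. 1 / (z - b)) holomorphic_on S"
      by (intro holomorphic_on_sum holinv)
    have "L holomorphic_on S" unfolding L_def S_def
      by (intro holomorphic_intros holomorphic_on_subset[OF holf] holomorphic_on_subset[OF holomorphic_deriv[OF holf]]) auto
    hence "(deriv ^^ k) L x = (deriv ^^ k) (\<lambda>z. deriv G z + (\<Sum>b\<in>a ` {..<N}. 1 / (z - b))) x"
      by (rule higher_deriv_transform_within_open[OF _ holomorphic_on_add[OF holG' holsum] \<open>open S\<close> \<open>x \<in> S\<close> L_eq])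
    also have "\<dots> = (deriv ^^ k) (deriv G) x + (\<Sum>b\<in>a ` {..<N}. (deriv ^^ k) (\<lambda>z. 1 / (z - b)) x)"
      unfolding higher_deriv_add[OF holG' holsum \<open>open S\<close> \<open>x \<in> S\<close>]
      by (subst higher_deriv_sum[OF _ holinv \<open>open S\<close> \<open>x \<in> S\<close>]) auto
    also have "(deriv ^^ k) (deriv G) x = (deriv ^^ Suc k) G x"
      by (simp only: funpow_Suc_right o_apply)
    also have "(\<Sum>b\<in>a ` {..<N}. (deriv ^^ k) (\<lambda>z. 1 / (z - b)) x) = (\<Sum>m<N. - fact k / (a m - x) ^ Suc k)"
    proof (subst sum.reindex)
      show "inj_on a {..<N}" using \<open>inj a\<close> by (rule inj_on_subset) simp
      have "x \<noteq> a m" for m using f_a[of m] \<open>f x \<noteq> 0\<close> by auto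
      thus "(\<Sum>m<N. ((\<lambda>b. (deriv ^^ k) (\<lambda>z. 1 / (z - b)) x) \<circ> a) m) = (\<Sum>m<N. - fact k / (a m - x) ^ Suc k)"
        unfolding o_apply by (intro sum.cong refl higher_deriv_inverse_linear)
    qed
    also have "(\<Sum>m<N. - fact k / (a m - x) ^ Suc k) = - (fact k * (\<Sum>m<N. 1 / (a m - x) ^ Suc k))"
      by (simp add: sum_distrib_left sum_negf del: power_Suc)
    finally have "(\<Sum>m<N. 1 / (a m - x) ^ Suc k) - (- (deriv ^^ k) L x / fact k) = (deriv ^^ Suc k) G x / fact k"
      by (simp add: field_simps del: power_Suc funpow.simps)
    hence "norm ((\<Sum>m<N. 1 / (a m - x) ^ Suc k) - (- (deriv ^^ k) L x / fact k)) = norm ((deriv ^^ Suc k) G x) / fact k"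
      by (simp add: norm_divide)
    also have "\<dots> \<le> (fact (Suc k) * (2 * M) / (R / 8) ^ Suc k) / fact k"
      by (intro divide_right_mono Gder) auto
    also have "\<dots> = M * (2 * 8 ^ Suc k * (1 + real k)) * inverse R ^ Suc k"
      unfolding fact_Suc power_divide power_inverse by (simp add: divide_simps del: power_Suc)
    \<comment> \<open>Since R is at least 1 and \<open>k \<ge> 1\<close>, two of the inverse powers
      of R suffice to beat the linear growth of \<open>M\<close>.\<close>
    also have "\<dots> \<le> ((A + 2 * c) * R) * (2 * 8 ^ Suc k * (1 + real k)) * inverse R ^ 2"
    proof (intro mult_mono)
      have "0 \<le> A" by (simp add: A_def)
      hence "A * 1 \<le> A * R" using \<open>1 \<le> R\<close> by (intro mult_left_mono)
      thus "M \<le> (A + 2 * c) * R" by (simp add: M_def algebra_simps)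
      show "inverse R ^ Suc k \<le> inverse R ^ 2"
        using \<open>1 \<le> R\<close> \<open>k \<ge> 1\<close> by (intro power_decreasing) (auto simp: field_simps)
    qed (use \<open>1 \<le> R\<close> \<open>0 \<le> c\<close> in \<open>auto simp: A_def\<close>)
    also have "\<dots> = C * inverse R" using \<open>0 < R\<close> unfolding C_def by (simp add: power2_eq_square field_simps)
    finally show ?thesis unfolding R_def .
  qed
  have "((\<lambda>N. (\<Sum>m<N. 1 / (a m - x) ^ Suc k) - (- (deriv ^^ k) L x / fact k)) \<longlongrightarrow> 0) sequentially"
  proof (rule Lim_null_comparison)
    show "eventually (\<lambda>N. norm ((\<Sum>m<N. 1 / (a m - x) ^ Suc k) - (- (deriv ^^ k) L x / fact k))
        \<le> C * inverse (norm (a N))) sequentially"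
      using filterlim_at_top[THEN iffD1, OF lim, rule_format, of "1 + 4 * norm x"]
      by eventually_elim (rule bound)
    show "((\<lambda>N. C * inverse (norm (a N))) \<longlongrightarrow> 0) sequentially"
      by (intro tendsto_mult_right_zero filterlim_compose[OF tendsto_inverse_0_at_top lim]
          tendsto_inverse_0_at_top lim)
  qed
  thus ?thesis unfolding sums_def L_def by (rule LIM_zero_cancel)
qed

section \<open>The entire part of the Bessel function\<close>

definition bes_coeff :: "real \<Rightarrow> nat \<Rightarrow> real" where
  "bes_coeff \<nu> m = (- 1 / 4) ^ m / (fact m * Gamma (real m + \<nu> + 1))"

text \<open>For \<open>\<nu> > -1\<close> this is the hypergeometric function 0F1 with parameter
  \<nu> + 1 at -z/4, divided by Gamma(\<nu> + 1). The generic type lets the real and the complex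
  function share their lemmas.\<close>

definition bes :: "real \<Rightarrow> 'a :: {real_normed_field, banach} \<Rightarrow> 'a" where
  "bes \<nu> z = (\<Sum>m. of_real (bes_coeff \<nu> m) * z ^ m)"

text \<open>The constant in front of exp(|z|/4) in the growth estimate: the reciprocal of a lower
  bound common to all \<open>Gamma (real m + \<nu> + 1)\<close>.\<close>

definition bes_bound :: "real \<Rightarrow> real" where
  "bes_bound \<nu> = 1 / (min 1 (\<nu> + 1) * Gamma (\<nu> + 1))"

lemma Gamma_shift_pos: "0 < Gamma (real m + \<nu> + 1)" if "\<nu> > -1"
  using that by (intro Gamma_real_pos) linarith

lemma Gamma_shift_rec: "Gamma (real m + \<nu> + 2) = (real m + \<nu> + 1) * Gamma (real m + \<nu> + 1)"
  if "\<nu> > -1"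
proof -
  have "real m + \<nu> + 1 \<notin> \<int>\<^sub>\<le>\<^sub>0" using that by (auto elim!: nonpos_Ints_cases')
  from Gamma_plus1[OF this] show ?thesis by (simp add: add.assoc)
qed

text \<open>In the functional equation only the first factor, \<nu> + 1, can be less than 1; every
  later factor m + \<nu> + 1 exceeds 1.\<close>

lemma Gamma_shift_lower_bound:
  assumes "\<nu> > (-1 :: real)"
  shows "min 1 (\<nu> + 1) * Gamma (\<nu> + 1) \<le> Gamma (real m + \<nu> + 1)"
proof (induction m)
  case 0
  show ?case using Gamma_shift_pos[OF assms, of 0] by (simp add: mult_le_cancel_right1)
next
  case (Suc m)
  have rec: "Gamma (real (Suc m) + \<nu> + 1) = (real m + \<nu> + 1) * Gamma (real m + \<nu> + 1)"
    using Gamma_shift_rec[OF assms, of m] by (simp add: add_ac)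
  show ?case
  proof (cases "m = 0")
    case True
    hence "Gamma (real (Suc m) + \<nu> + 1) = (\<nu> + 1) * Gamma (\<nu> + 1)" using rec by simp
    moreover have "min 1 (\<nu> + 1) * Gamma (\<nu> + 1) \<le> (\<nu> + 1) * Gamma (\<nu> + 1)"
      using Gamma_shift_pos[OF assms, of 0] by (intro mult_right_mono) auto
    ultimately show ?thesis by simp
  next
    case False
    have "1 * Gamma (real m + \<nu> + 1) \<le> (real m + \<nu> + 1) * Gamma (real m + \<nu> + 1)"
      by (intro mult_right_mono less_imp_le[OF Gamma_shift_pos]) (use False assms in auto)
    thus ?thesis using Suc.IH unfolding rec by simp
  qed
qed

lemma abs_bes_coeff_le:
  assumes "\<nu> > -1"
  shows "\<bar>bes_coeff \<nu> m\<bar> \<le> (1 / 4) ^ m / fact m * bes_bound \<nu>"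
proof -
  have "0 < Gamma (\<nu> + 1)" using Gamma_shift_pos[OF assms, of 0] by simp
  hence pos: "0 < min 1 (\<nu> + 1) * Gamma (\<nu> + 1)" using assms by simp
  have "0 < Gamma (real m + \<nu> + 1)" by (rule Gamma_shift_pos[OF assms])
  hence "\<bar>bes_coeff \<nu> m\<bar> = (1 / 4) ^ m / fact m * (1 / Gamma (real m + \<nu> + 1))"
    by (simp add: bes_coeff_def abs_mult power_abs)
  also have "\<dots> \<le> (1 / 4) ^ m / fact m * bes_bound \<nu>"
    unfolding bes_bound_def
    using Gamma_shift_lower_bound[OF assms, of m] pos by (intro mult_left_mono divide_left_mono) auto
  finally show ?thesis .
qed

lemma norm_bes_term_le:
  fixes z :: "'a :: {real_normed_field, banach}"
  assumes "\<nu> > -1"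
  shows "norm (of_real (bes_coeff \<nu> m) * z ^ m) \<le> (norm z / 4) ^ m /\<^sub>R fact m * bes_bound \<nu>"
  using mult_right_mono[OF abs_bes_coeff_le[OF assms, of m], of "norm z ^ m"]
  by (simp add: norm_mult norm_power field_simps)

lemma summable_bes:
  fixes z :: "'a :: {real_normed_field, banach}"
  assumes "\<nu> > -1"
  shows "summable (\<lambda>m. norm (of_real (bes_coeff \<nu> m) * z ^ m))"
  by (rule summable_comparison_test'[OF summable_mult2[OF summable_exp_generic[of "norm z / 4"], of "bes_bound \<nu>"], of 0])
    (use norm_bes_term_le[OF assms] in simp)

lemma sums_bes:
  fixes z :: "'a :: {real_normed_field, banach}"
  assumes "\<nu> > -1"
  shows "(\<lambda>m. of_real (bes_coeff \<nu> m) * z ^ m) sums bes \<nu> z"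
  unfolding bes_def using summable_norm_cancel[OF summable_bes[OF assms]] by (rule summable_sums)

lemma norm_bes_le:
  fixes z :: "'a :: {real_normed_field, banach}"
  assumes "\<nu> > -1"
  shows "norm (bes \<nu> z) \<le> bes_bound \<nu> * exp (1 / 4 * norm z)"
proof -
  have "norm (bes \<nu> z) \<le> (\<Sum>m. norm (of_real (bes_coeff \<nu> m) * z ^ m))"
    unfolding bes_def by (rule summable_norm[OF summable_bes[OF assms]])
  also have "\<dots> \<le> (\<Sum>m. (norm z / 4) ^ m /\<^sub>R fact m * bes_bound \<nu>)"
    by (intro suminf_le norm_bes_term_le summable_bes assms summable_mult2 summable_exp_generic)
  also have "\<dots> = exp (norm z / 4) * bes_bound \<nu>"
    unfolding exp_def by (intro suminf_mult2[symmetric] summable_exp_generic)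
  finally show ?thesis by (simp add: mult_ac)
qed

lemma bes_coeff_Suc:
  shows "(real m + 1) * bes_coeff \<nu> (Suc m) = - bes_coeff (\<nu> + 1) m / 4"
  by (simp add: bes_coeff_def add_ac divide_simps)

lemma has_field_derivative_bes:
  fixes z :: "'a :: {real_normed_field, banach}"
  assumes "\<nu> > -1"
  shows "(bes \<nu> has_field_derivative - bes (\<nu> + 1) z / 4) (at z)"
proof -
  have "((\<lambda>z. \<Sum>m. of_real (bes_coeff \<nu> m) * z ^ m) has_field_derivative
      (\<Sum>m. diffs (\<lambda>m. of_real (bes_coeff \<nu> m)) m * z ^ m)) (at z)"
    by (rule termdiffs_strong_converges_everywhere) (rule summable_norm_cancel[OF summable_bes[OF assms]])
  also have "(\<lambda>m. diffs (\<lambda>m. of_real (bes_coeff \<nu> m)) m * z ^ m)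
      = (\<lambda>m. of_real (bes_coeff (\<nu> + 1) m) * z ^ m * (- 1 / 4))"
  proof
    fix m
    have "diffs (\<lambda>m. of_real (bes_coeff \<nu> m)) m = (of_real ((real m + 1) * bes_coeff \<nu> (Suc m)) :: 'a)"
      by (simp add: diffs_def add_ac)
    thus "diffs (\<lambda>m. of_real (bes_coeff \<nu> m)) m * z ^ m = of_real (bes_coeff (\<nu> + 1) m) * z ^ m * (- 1 / 4)"
      unfolding bes_coeff_Suc by simp
  qed
  also have "(\<Sum>m. of_real (bes_coeff (\<nu> + 1) m) * z ^ m * (- 1 / 4)) = bes (\<nu> + 1) z * (- 1 / 4)"
    by (intro sums_unique[symmetric] sums_mult2 sums_bes) (use assms in simp)
  finally show ?thesis unfolding bes_def[abs_def] by simp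
qed

text \<open>The three-term recurrence of the Bessel functions in entire form, by comparison of
  coefficients.\<close>

lemma bes_recurrence:
  fixes z :: "'a :: {real_normed_field, banach}"
  assumes "\<nu> > -1"
  shows "z * bes (\<nu> + 2) z = 4 * (of_real (\<nu> + 1) * bes (\<nu> + 1) z - bes \<nu> z)"
proof -
  define t where "t = (\<lambda>m. 4 * (of_real (\<nu> + 1) * (of_real (bes_coeff (\<nu> + 1) m) * z ^ m) - of_real (bes_coeff \<nu> m) * z ^ m))"
  have t: "t = (\<lambda>m. of_real (4 * ((\<nu> + 1) * bes_coeff (\<nu> + 1) m - bes_coeff \<nu> m)) * z ^ m)"
    by (simp add: t_def algebra_simps)
  have Gamma_rec: "Gamma (real m + \<nu> + 2) = (real m + \<nu> + 1) * Gamma (real m + \<nu> + 1)" for m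
    by (rule Gamma_shift_rec[OF assms])
  have Gamma_nz: "Gamma (real m + \<nu> + 1) \<noteq> 0" for m
    using Gamma_shift_pos[OF assms, of m] by simp
  have "t sums (4 * (of_real (\<nu> + 1) * bes (\<nu> + 1) z - bes \<nu> z))"
    unfolding t_def by (intro sums_mult sums_diff sums_bes) (use assms in auto)
  moreover have "t sums (z * bes (\<nu> + 2) z)"
  proof -
    \<comment> \<open>The constant term cancels by the functional equation of Gamma, which frees the
      factor \<open>z\<close> and shifts the index by one.\<close>
    have "t 0 = 0"
    proof -
      have "Gamma (\<nu> + 1 + 1) = (\<nu> + 1) * Gamma (\<nu> + 1)" using Gamma_rec[of 0] by (simp add: add.assoc)
      thus ?thesis using Gamma_nz[of 0] assms unfolding t by (simp add: bes_coeff_def)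
    qed
    moreover have "t (Suc m) = z * (of_real (bes_coeff (\<nu> + 2) m) * z ^ m)" for m
    proof -
      have "4 * ((\<nu> + 1) * bes_coeff (\<nu> + 1) (Suc m) - bes_coeff \<nu> (Suc m)) = bes_coeff (\<nu> + 2) m"
        using Gamma_rec[of "Suc m"] Gamma_nz[of "Suc m"] assms
        unfolding bes_coeff_def by (simp add: add_ac divide_simps) (simp add: algebra_simps)
      thus ?thesis unfolding t by (simp add: mult_ac)
    qed
    hence "(\<lambda>m. t (Suc m)) sums (z * bes (\<nu> + 2) z)"
      using sums_mult[OF sums_bes[of "\<nu> + 2" z], of z] assms by simp
    ultimately show ?thesis using sums_Suc_iff[of t "z * bes (\<nu> + 2) z"] by simp
  qed
  ultimately show ?thesis using sums_unique2 by blast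
qed

lemma bes_of_real: "bes \<nu> (of_real x :: 'a :: {real_normed_field, banach}) = of_real (bes \<nu> x)" if "\<nu> > -1"
proof -
  have "(\<lambda>m. of_real (bes_coeff \<nu> m * x ^ m) :: 'a) sums of_real (bes \<nu> x)"
    using sums_bes[OF that, of x] by (intro sums_of_real) simp
  thus ?thesis using sums_bes[OF that, of "of_real x :: 'a"] sums_unique2 by fastforce
qed

lemma bes_0_nonzero: "bes \<nu> (0 :: 'a :: {real_normed_field, banach}) \<noteq> 0" if "\<nu> > -1"
proof -
  have "Gamma (\<nu> + 1) \<noteq> 0" using Gamma_shift_pos[OF that, of 0] by simp
  hence "bes_coeff \<nu> 0 \<noteq> 0" by (simp add: bes_coeff_def)
  moreover have "bes \<nu> (0 :: 'a) = of_real (bes_coeff \<nu> 0)"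
    unfolding bes_def using powser_zero[of "\<lambda>m. of_real (bes_coeff \<nu> m) :: 'a"] by simp
  ultimately show ?thesis by simp
qed

text \<open>For nonpositive arguments the signs of the series cancel: all terms are nonnegative and
  the constant one is positive. This excludes nonpositive zeros.\<close>

lemma bes_pos:
  assumes "\<nu> > -1" and "(x :: real) \<le> 0"
  shows "0 < bes \<nu> x"
proof -
  have "0 \<le> bes_coeff \<nu> m * x ^ m" for m
  proof -
    have "bes_coeff \<nu> m * x ^ m = (- x / 4) ^ m / (fact m * Gamma (real m + \<nu> + 1))"
      by (simp add: bes_coeff_def power_mult_distrib[symmetric])
    moreover have "0 < Gamma (real m + \<nu> + 1)" by (rule Gamma_shift_pos[OF assms(1)])
    ultimately show ?thesis using assms by simp
  qed
  hence "0 \<le> (\<Sum>m. bes_coeff \<nu> (Suc m) * x ^ Suc m)"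
    using summable_norm_cancel[OF summable_bes[OF assms(1), of x]] summable_Suc_iff[of "\<lambda>m. bes_coeff \<nu> m * x ^ m"]
    by (intro suminf_nonneg) (auto simp del: power_Suc)
  moreover have "0 < bes_coeff \<nu> 0"
    using Gamma_shift_pos[OF assms(1), of 0] by (simp add: bes_coeff_def)
  moreover have "bes \<nu> x = bes_coeff \<nu> 0 + (\<Sum>m. bes_coeff \<nu> (Suc m) * x ^ Suc m)"
    using sums_bes[OF assms(1), of x] suminf_split_head[of "\<lambda>m. bes_coeff \<nu> m * x ^ m"]
    by (auto simp: sums_iff bes_def)
  ultimately show ?thesis by linarith
qed

lemma bessel_J_eq_bes:
  assumes "\<nu> > -1" "x > 0"
  shows "bessel_J \<nu> x = (x / 2) powr \<nu> * bes \<nu> (x\<^sup>2)"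
proof -
  have "(- 1) ^ m / (fact m * Gamma (real m + \<nu> + 1)) * (x / 2) powr (2 * real m + \<nu>)
      = (x / 2) powr \<nu> * (bes_coeff \<nu> m * (x\<^sup>2) ^ m)" for m
  proof -
    have "(x / 2) powr (2 * real m + \<nu>) = (x / 2) powr real (2 * m) * (x / 2) powr \<nu>"
      by (simp add: powr_add)
    also have "(x / 2) powr real (2 * m) = ((x / 2)\<^sup>2) ^ m"
      using assms by (subst powr_realpow) (simp_all add: power_mult)
    also have "((x / 2)\<^sup>2) ^ m = (1 / 4) ^ m * (x\<^sup>2) ^ m"
      by (simp add: power_divide)
    finally have *: "(x / 2) powr (2 * real m + \<nu>) = (1 / 4) ^ m * (x\<^sup>2) ^ m * (x / 2) powr \<nu>" .
    have "(- 1 / 4 :: real) ^ m = (- 1) ^ m * (1 / 4) ^ m"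
      by (subst power_mult_distrib[symmetric]) simp
    thus ?thesis unfolding * bes_coeff_def by (simp only: times_divide_eq_left times_divide_eq_right mult_ac)
  qed
  thus ?thesis unfolding bessel_J_def
    using sums_mult[OF sums_bes[OF assms(1), of "x\<^sup>2"], of "(x / 2) powr \<nu>"] by (simp add: sums_iff)
qed

lemma bessel_J_zero_iff:
  assumes "\<nu> > -1" "x > 0"
  shows "bessel_J \<nu> x = 0 \<longleftrightarrow> bes \<nu> (x\<^sup>2) = 0"
  using assms by (simp add: bessel_J_eq_bes)

section \<open>Logarithmic derivative and Riccati equation\<close>

definition bes_logderiv :: "real \<Rightarrow> 'a :: {real_normed_field, banach} \<Rightarrow> 'a" where
  "bes_logderiv \<nu> z = bes (\<nu> + 1) z / (4 * bes \<nu> z)"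

lemma D_eq_bes_logderiv:
  assumes "p > -1" "x > 0"
  shows "D p x = bes_logderiv p x"
proof -
  have "D p x = (sqrt x / 2) powr p * (sqrt x / 2) * bes (p + 1) x
      / (2 * sqrt x * ((sqrt x / 2) powr p * bes p x))"
    using assms by (simp add: D_def bessel_J_eq_bes powr_add)
  \<comment> \<open>At a zero of \<open>bes p\<close> both quotients are 0 by the convention on
    division.\<close>
  also have "\<dots> = bes_logderiv p x"
    using assms unfolding bes_logderiv_def by (cases "bes p x = 0") (simp_all add: divide_simps)
  finally show ?thesis .
qed

text \<open>The quotient rule produces order \<nu> + 2, which \<open>bes_recurrence\<close>
  eliminates only together with a factor \<open>z\<close>; hence the equation is stated for
  \<open>z * d\<close>.\<close>

lemma bes_riccati:
  fixes z :: "'a :: {real_normed_field, banach}"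
  assumes "\<nu> > -1" "bes \<nu> z \<noteq> 0"
  obtains d where "(bes_logderiv \<nu> has_field_derivative d) (at z)"
    and "z * d = z * (bes_logderiv \<nu> z)\<^sup>2 - of_real (\<nu> + 1) * bes_logderiv \<nu> z + 1 / 4"
proof
  define d where "d = (bes_logderiv \<nu> z)\<^sup>2 - bes (\<nu> + 2) z / (16 * bes \<nu> z)"
  have "((\<lambda>z. bes (\<nu> + 1) z / (4 * bes \<nu> z)) has_field_derivative
      ((- bes (\<nu> + 1 + 1) z / 4) * (4 * bes \<nu> z) - bes (\<nu> + 1) z * (4 * (- bes (\<nu> + 1) z / 4)))
      / ((4 * bes \<nu> z) * (4 * bes \<nu> z))) (at z)"
    using assms by (intro DERIV_divide has_field_derivative_bes DERIV_cmult) auto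
  moreover have "((- bes (\<nu> + 1 + 1) z / 4) * (4 * bes \<nu> z) - bes (\<nu> + 1) z * (4 * (- bes (\<nu> + 1) z / 4)))
      / ((4 * bes \<nu> z) * (4 * bes \<nu> z)) = d"
    using assms by (simp add: d_def bes_logderiv_def field_simps power2_eq_square)
  ultimately show "(bes_logderiv \<nu> has_field_derivative d) (at z)"
    unfolding bes_logderiv_def[abs_def] by simp
  have "z * d = z * (bes_logderiv \<nu> z)\<^sup>2 - (z * bes (\<nu> + 2) z) / (16 * bes \<nu> z)"
    by (simp add: d_def algebra_simps)
  also have "(z * bes (\<nu> + 2) z) / (16 * bes \<nu> z) = of_real (\<nu> + 1) * bes_logderiv \<nu> z - 1 / 4"
    unfolding bes_recurrence[OF assms(1)] bes_logderiv_def using assms(2)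
    by (simp add: divide_simps)
  finally show "z * d = z * (bes_logderiv \<nu> z)\<^sup>2 - of_real (\<nu> + 1) * bes_logderiv \<nu> z + 1 / 4"
    by simp
qed

section \<open>Location of the zeros\<close>

lemma bes_logderiv_of_real:
  assumes "\<nu> > -1"
  shows "bes_logderiv \<nu> (of_real x :: 'a :: {real_normed_field, banach}) = of_real (bes_logderiv \<nu> x)"
  using assms by (simp add: bes_logderiv_def bes_of_real)

lemma holomorphic_on_bes: "bes \<nu> holomorphic_on S" if "\<nu> > -1"
  using has_field_derivative_bes[OF that]
  by (auto simp: holomorphic_on_def field_differentiable_def intro: has_field_derivative_at_within)

lemma deriv_bes: "deriv (bes \<nu>) z = - bes (\<nu> + 1) z / 4" if "\<nu> > -1"
  using has_field_derivative_bes[OF that] by (rule DERIV_imp_deriv)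

text \<open>If two consecutive orders vanish at \<open>z\<close>, which is not 0, the recurrence
  makes all higher orders vanish there. These are the derivatives of \<open>bes \<nu>\<close> up to
  constants, so the function would be identically 0, against its value at the origin.\<close>

lemma bes_simple_zero:
  fixes z :: complex
  assumes "\<nu> > -1" "bes \<nu> z = 0"
  shows "bes (\<nu> + 1) z \<noteq> 0"
proof
  assume Suc0: "bes (\<nu> + 1) z = 0"
  have "z \<noteq> 0" using assms bes_0_nonzero by metis
  have vanish: "bes (\<nu> + real k) z = 0 \<and> bes (\<nu> + real k + 1) z = 0" for k
  proof (induction k)
    case (Suc k)
    have "z * bes (\<nu> + real k + 2) z = 0"
      using Suc bes_recurrence[of "\<nu> + real k" z] assms by simp
    with Suc \<open>z \<noteq> 0\<close> show ?case by (simp add: algebra_simps)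
  qed (use assms Suc0 in simp)
  have higher: "(deriv ^^ k) (bes \<nu>) (w :: complex) = (- 1 / 4) ^ k * bes (\<nu> + real k) w" for k and w :: complex
  proof (induction k arbitrary: w)
    case (Suc k)
    have "(deriv ^^ k) (bes \<nu>) = (\<lambda>w :: complex. (- 1 / 4) ^ k * bes (\<nu> + real k) w)"
      by (rule ext) (rule Suc.IH)
    hence "(deriv ^^ Suc k) (bes \<nu>) w = deriv (\<lambda>w. (- 1 / 4) ^ k * bes (\<nu> + real k) w) w"
      by simp
    also have "\<dots> = (- 1 / 4) ^ k * (- bes (\<nu> + real k + 1) w / 4)"
      by (intro DERIV_imp_deriv DERIV_cmult has_field_derivative_bes) (use assms in auto)
    finally show ?case by (simp add: algebra_simps)
  qed simp
  have "bes \<nu> 0 = (0 :: complex)"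
    using holomorphic_fun_eq_0_on_connected[OF holomorphic_on_bes[OF assms(1)], of UNIV z 0]
      higher vanish connected_UNIV by simp
  thus False using bes_0_nonzero[OF assms(1)] by blast
qed

text \<open>With \<open>A(t) = bes \<nu> (tz)\<close> and \<open>B(t) = bes (\<nu> + 1) (tz)\<close>, the equation of Sturm--Liouville type for
  \<open>A\<close> gives \<open>(t\<^sup>\<nu>\<^sup>+\<^sup>1 Im (z B cnj A))' = t\<^sup>\<nu> |A|\<^sup>2 Im z\<close>.  The bracket vanishes at \<open>0\<close> and at the
  first zero of \<open>A\<close>, so Rolle's theorem forces \<open>Im z = 0\<close>.\<close>

lemma bes_zero_real:
  fixes z :: complex
  assumes \<nu>: "\<nu> > -1" and "bes \<nu> z = 0"
  shows "Im z = 0"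
proof -
  define A where "A = (\<lambda>t::real. bes \<nu> (of_real t * z))"
  define B where "B = (\<lambda>t::real. bes (\<nu> + 1) (of_real t * z))"
  have der_bes: "((\<lambda>t. bes \<mu> (of_real t * z)) has_vector_derivative z * (- bes (\<mu> + 1) (of_real t * z) / 4)) (at t)"
    if "\<mu> > -1" for \<mu> t
  proof -
    have "((\<lambda>t. of_real t * z) has_vector_derivative z) (at t)"
      using bounded_linear_imp_has_derivative[OF bounded_linear_scaleR_left[of z]]
      by (simp add: has_vector_derivative_def scaleR_conv_of_real)
    from field_vector_diff_chain_at[OF this has_field_derivative_bes[OF that]]
    show ?thesis by (simp add: o_def)
  qed
  have derA: "(A has_vector_derivative z * (- B t / 4)) (at t)" for t
    unfolding A_def B_def by (rule der_bes[OF \<nu>])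
  have derB: "(B has_vector_derivative z * (- bes (\<nu> + 2) (of_real t * z) / 4)) (at t)" for t
    unfolding B_def using der_bes[of "\<nu> + 1" t] \<nu> by (simp add: add.assoc)
  have "isCont A t" "isCont B t" for t
    using has_vector_derivative_continuous[OF derA] has_vector_derivative_continuous[OF derB] by blast+
  hence contA: "continuous_on UNIV A" and contB: "continuous_on UNIV B"
    by (simp_all add: continuous_at_imp_continuous_on)
  have "compact ({0..1} \<inter> A -` {0})"
    by (intro compact_Int_closed closed_vimage contA) auto
  moreover have "1 \<in> {0..1} \<inter> A -` {0}" using assms by (simp add: A_def)
  \<comment> \<open>The first zero is chosen so that \<open>A\<close> does not vanish before
    \<open>s\<close>; the point supplied by Rolle's theorem then satisfies
    \<open>A t \<noteq> 0\<close>.\<close>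
  ultimately obtain s where s: "s \<in> {0..1} \<inter> A -` {0}" "\<And>t. t \<in> {0..1} \<inter> A -` {0} \<Longrightarrow> s \<le> t"
    using compact_attains_inf[of "{0..1} \<inter> A -` {0}"] by blast
  have "A 0 \<noteq> 0" using bes_0_nonzero[OF \<nu>] by (simp add: A_def)
  with s have "0 < s" by (cases "s = 0") auto
  define h where "h = (\<lambda>t. t powr (\<nu> + 1) * Im (z * B t * cnj (A t)))"
  have derh: "(h has_real_derivative t powr \<nu> * (norm (A t))\<^sup>2 * Im z) (at t)" if "t > 0" for t
  proof -
    let ?B' = "z * (- bes (\<nu> + 2) (of_real t * z) / 4)" and ?A' = "z * (- B t / 4)"
    have "((\<lambda>t. Im (z * B t * cnj (A t))) has_real_derivative
        Im (z * B t * cnj ?A' + z * ?B' * cnj (A t))) (at t)"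
      by (intro has_field_derivative_Im has_vector_derivative_mult has_vector_derivative_cnj
          has_vector_derivative_mult_right derA derB)
    hence "(h has_real_derivative (\<nu> + 1) * t powr \<nu> * Im (z * B t * cnj (A t))
        + Im (z * B t * cnj ?A' + z * ?B' * cnj (A t)) * t powr (\<nu> + 1)) (at t)"
      unfolding h_def using DERIV_mult[OF has_real_derivative_powr[OF that, of "\<nu> + 1"]] by simp
    moreover have "(\<nu> + 1) * t powr \<nu> * Im (z * B t * cnj (A t))
        + Im (z * B t * cnj ?A' + z * ?B' * cnj (A t)) * t powr (\<nu> + 1) = t powr \<nu> * (norm (A t))\<^sup>2 * Im z"
    proof -
      \<comment> \<open>Moves real multiples inside \<open>Im\<close>, so that the identity can be
        checked between complex numbers.\<close>
      have Im_eq: "r * Im u + s * Im v = Im w" if "of_real r * u + of_real s * v = w" for r s u v w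
        using arg_cong[OF that, of Im] by simp
      have "of_real t * (z * ?B') = - z * (of_real t * z * bes (\<nu> + 2) (of_real t * z)) / 4" by simp
      also have "\<dots> = - z * (of_real (\<nu> + 1) * B t - A t)"
        unfolding bes_recurrence[OF \<nu>] by (simp add: A_def B_def)
      finally have B': "of_real t * (z * ?B') = - z * (of_real (\<nu> + 1) * B t - A t)" .
      have "of_real (\<nu> + 1) * (z * B t * cnj (A t)) + of_real t * (z * B t * cnj ?A' + z * ?B' * cnj (A t))
          = of_real (\<nu> + 1) * (z * B t * cnj (A t)) + of_real t * (z * B t * cnj ?A')
            + of_real t * (z * ?B') * cnj (A t)"
        by (simp add: algebra_simps)
      \<comment> \<open>The last term is real, a multiple of the squared modulus of
        \<open>z * B t\<close>, and so drops out of the imaginary part.\<close>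
      also have "\<dots> = z * (A t * cnj (A t)) - of_real (t / 4) * ((z * B t) * cnj (z * B t))"
        unfolding B' by (simp add: algebra_simps)
      finally have "(\<nu> + 1) * Im (z * B t * cnj (A t)) + t * Im (z * B t * cnj ?A' + z * ?B' * cnj (A t))
          = Im (z * (A t * cnj (A t)) - of_real (t / 4) * ((z * B t) * cnj (z * B t)))"
        by (rule Im_eq)
      also have "\<dots> = Im z * (norm (A t))\<^sup>2"
        unfolding complex_norm_square[symmetric] by simp
      finally have main: "(\<nu> + 1) * Im (z * B t * cnj (A t)) + t * Im (z * B t * cnj ?A' + z * ?B' * cnj (A t))
          = Im z * (norm (A t))\<^sup>2" .
      have pw: "(\<nu> + 1) * t powr \<nu> * u + v * t powr (\<nu> + 1) = t powr \<nu> * ((\<nu> + 1) * u + t * v)" for u v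
        using that by (simp add: powr_add algebra_simps)
      show ?thesis unfolding pw main by (simp only: mult_ac)
    qed
    ultimately show ?thesis by simp
  qed
  \<comment> \<open>At the left end point this rests on \<nu> + 1 > 0, which makes the power of
    \<open>t\<close> continuous with value 0.\<close>
  have "continuous_on {0..s} h"
    unfolding h_def using \<nu>
    by (intro continuous_intros continuous_on_subset[OF contA] continuous_on_subset[OF contB]
        continuous_on_powr') auto
  moreover have "h 0 = h s" using s by (simp add: h_def)
  moreover have "h differentiable (at t)" if "0 < t" for t
    using derh[OF that] real_differentiable_def by blast
  ultimately obtain t where t: "0 < t" "t < s" "DERIV h t :> 0"
    using Rolle[OF \<open>0 < s\<close>, of h] by auto
  hence "t powr \<nu> * (norm (A t))\<^sup>2 * Im z = 0" using derh[of t] DERIV_unique by blast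
  moreover have "A t \<noteq> 0" using s(1) s(2)[of t] t by auto
  ultimately show ?thesis using t by simp
qed

text \<open>Without zeros beyond \<open>X\<close> the Riccati equation has a solution
  \<open>y\<close> on a whole half-line. But there arctan(2y) would grow at least at rate 1/2,
  although its range has length pi.\<close>

lemma bes_zeros_unbounded:
  assumes \<nu>: "\<nu> > -1"
  shows "\<exists>x>X. bes \<nu> x = (0 :: real)"
proof (rule ccontr)
  assume "\<not> ?thesis"
  hence nz: "bes \<nu> x \<noteq> 0" if "x > X" for x :: real using that by blast
  define a where "a = \<nu> + 1 / 2"
  \<comment> \<open>\<open>T\<close> lies beyond \<open>X\<close>, is at least 1, and makes |a -
    a^2| / t^2 at most 1/4 for all \<open>t \<ge> T\<close>.\<close>
  define T where "T = 1 + \<bar>X\<bar> + 4 * \<bar>a - a\<^sup>2\<bar>"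
  define q where "q = (bes_logderiv \<nu> :: real \<Rightarrow> real)"
  \<comment> \<open>Minus the logarithmic derivative of sqrt(t) J(t), with J of order \<nu>. This
    Liouville normal form removes the linear term: y' = y^2 + 1 + (a - a^2) / t^2.\<close>
  define y where "y = (\<lambda>t. - a / t + 2 * t * q (t\<^sup>2))"
  have "T \<ge> 1" by (simp add: T_def)
  have "\<exists>d. ((\<lambda>t. arctan (2 * y t) - t / 2) has_real_derivative d) (at t) \<and> 0 \<le> d" if "t \<ge> T" for t
  proof -
    have "1 \<le> t" using that \<open>T \<ge> 1\<close> by simp
    hence "t \<le> t\<^sup>2" by (simp add: power2_eq_square)
    hence "T \<le> t\<^sup>2" using that by simp
    moreover have "0 \<le> 4 * \<bar>a - a\<^sup>2\<bar>" by simp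
    hence "X < T" unfolding T_def using abs_ge_self[of X] by (simp only: T_def)
    ultimately have "X < t\<^sup>2" by simp
    then obtain d where d: "(q has_real_derivative d) (at (t\<^sup>2))"
        "t\<^sup>2 * d = t\<^sup>2 * (q (t\<^sup>2))\<^sup>2 - (\<nu> + 1) * q (t\<^sup>2) + 1 / 4"
      using bes_riccati[OF \<nu> nz] unfolding q_def by (metis of_real_eq_id id_apply)
    have "((\<lambda>t. q (t\<^sup>2)) has_real_derivative d * (2 * t)) (at t)"
      by (rule DERIV_chain2[where g = "\<lambda>t. t\<^sup>2", OF d(1)]) (auto intro!: derivative_eq_intros)
    hence "(y has_real_derivative a / t\<^sup>2 + (2 * q (t\<^sup>2) + 2 * t * (d * (2 * t)))) (at t)"
      unfolding y_def using \<open>1 \<le> t\<close> by (auto intro!: derivative_eq_intros simp: power2_eq_square)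
    moreover have "a / t\<^sup>2 + (2 * q (t\<^sup>2) + 2 * t * (d * (2 * t))) = (y t)\<^sup>2 + 1 + (a - a\<^sup>2) / t\<^sup>2"
    proof -
      have "2 * t * (d * (2 * t)) = 4 * (t\<^sup>2 * d)" by (simp add: power2_eq_square)
      moreover have y2: "(y t)\<^sup>2 = a\<^sup>2 / t\<^sup>2 - 4 * a * q (t\<^sup>2) + 4 * (t\<^sup>2 * (q (t\<^sup>2))\<^sup>2)"
        using \<open>1 \<le> t\<close> by (simp add: y_def power2_eq_square field_simps)
      ultimately have "a / t\<^sup>2 + (2 * q (t\<^sup>2) + 2 * t * (d * (2 * t)))
          = a / t\<^sup>2 + 2 * q (t\<^sup>2) + 4 * (t\<^sup>2 * (q (t\<^sup>2))\<^sup>2 - (\<nu> + 1) * q (t\<^sup>2) + 1 / 4)"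
        using d(2) by simp
      also have "\<dots> = (y t)\<^sup>2 + 1 + (a - a\<^sup>2) / t\<^sup>2"
        unfolding y2 by (simp add: a_def diff_divide_distrib algebra_simps)
      finally show ?thesis .
    qed
    ultimately have y': "(y has_real_derivative (y t)\<^sup>2 + 1 + (a - a\<^sup>2) / t\<^sup>2) (at t)" by simp
    have "((\<lambda>t. 2 * y t) has_real_derivative 2 * ((y t)\<^sup>2 + 1 + (a - a\<^sup>2) / t\<^sup>2)) (at t)"
      by (intro DERIV_cmult y')
    from DERIV_diff[OF DERIV_chain2[OF DERIV_arctan this] DERIV_cdivide[OF DERIV_ident, where c = 2]]
    have "((\<lambda>t. arctan (2 * y t) - t / 2) has_real_derivative
        2 * ((y t)\<^sup>2 + 1 + (a - a\<^sup>2) / t\<^sup>2) / (1 + (2 * y t)\<^sup>2) - 1 / 2) (at t)"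
      by (simp only: divide_inverse mult.commute)
    moreover have "0 \<le> 2 * ((y t)\<^sup>2 + 1 + (a - a\<^sup>2) / t\<^sup>2) / (1 + (2 * y t)\<^sup>2) - 1 / 2"
    proof -
      define w where "w = (a - a\<^sup>2) / t\<^sup>2"
      have "4 * \<bar>a - a\<^sup>2\<bar> \<le> t\<^sup>2" using \<open>T \<le> t\<^sup>2\<close> unfolding T_def by linarith
      hence "\<bar>w\<bar> \<le> 1 / 4" using \<open>1 \<le> t\<close> by (simp add: w_def abs_divide field_simps)
      hence "- 1 / 4 \<le> w" by linarith
      moreover have "(1 + (2 * y t)\<^sup>2) / 4 = 1 / 4 + (y t)\<^sup>2"
        by (simp add: power_mult_distrib add_divide_distrib)
      ultimately have "(1 + (2 * y t)\<^sup>2) / 4 \<le> (y t)\<^sup>2 + 1 + (a - a\<^sup>2) / t\<^sup>2"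
        unfolding w_def[symmetric] by linarith
      moreover have "0 < 1 + (2 * y t)\<^sup>2" by (simp add: add_pos_nonneg)
      ultimately show ?thesis by (simp add: field_simps)
    qed
    ultimately show ?thesis by blast
  qed
  \<comment> \<open>An interval of length 8 forces arctan to increase by at least 4, which exceeds
    pi.\<close>
  hence *: "arctan (2 * y T) - T / 2 \<le> arctan (2 * y (T + 8)) - (T + 8) / 2"
    by (intro DERIV_nonneg_imp_nondecreasing[of T "T + 8" "\<lambda>t. arctan (2 * y t) - t / 2"]) auto
  define \<phi> where "\<phi> = (\<lambda>t. arctan (2 * y t))"
  have "\<phi> T - T / 2 \<le> \<phi> (T + 8) - (T + 8) / 2" using * by (simp add: \<phi>_def)
  moreover have "- (pi / 2) < \<phi> T" "\<phi> (T + 8) < pi / 2"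
    unfolding \<phi>_def by (rule arctan_lbound, rule arctan_ubound)
  ultimately show False using pi_less_4 by (simp add: field_simps)
qed

section \<open>Enumeration of the positive zeros\<close>

text \<open>The counting function \<open>c\<close> is strictly increasing on \<open>S\<close> and
  takes every positive integer value, so it can be inverted. The cardinality clause has the shape
  used in \<open>bessel_zero\<close>.\<close>

lemma discrete_set_enumeration:
  fixes S :: "real set"
  assumes fin: "\<And>x. finite {z \<in> S. z \<le> x}" and unbounded: "\<And>x. \<exists>z\<in>S. x < z"
  obtains a :: "nat \<Rightarrow> real" where "strict_mono a" "range a = S" "\<And>m. card {z \<in> S. z \<le> a m} = Suc m"
proof -
  define c where "c = (\<lambda>x. card {z \<in> S. z \<le> x})"
  have c_less: "c x < c y" if "x < y" "y \<in> S" for x y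
  proof -
    have "y \<in> {z \<in> S. z \<le> y} - {z \<in> S. z \<le> x}" using that by auto
    moreover have "{z \<in> S. z \<le> x} \<subseteq> {z \<in> S. z \<le> y}" using that by auto
    ultimately show ?thesis unfolding c_def by (intro psubset_card_mono fin) blast
  qed
  have c_le: "c x \<le> c y" if "x \<le> y" for x y
    unfolding c_def using that by (intro card_mono fin) auto
  \<comment> \<open>The least element above \<open>x\<close> raises the count by exactly one, so no
    value of \<open>c\<close> is skipped.\<close>
  have next_elem: "\<exists>y\<in>S. x < y \<and> {z \<in> S. z \<le> y} = insert y {z \<in> S. z \<le> x}" for x
  proof -
    obtain s where s: "s \<in> S" "x < s" using unbounded by blast
    let ?B = "{z \<in> S. x < z \<and> z \<le> s}"
    have B: "finite ?B" "?B \<noteq> {}" using finite_subset[OF _ fin[of s], of ?B] s by auto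
    show ?thesis
    proof (intro bexI[of _ "Min ?B"] conjI)
      show "{z \<in> S. z \<le> Min ?B} = insert (Min ?B) {z \<in> S. z \<le> x}"
        using Min_in[OF B] Min_le[OF B(1)] by (auto simp: not_le) (meson leI le_less_trans less_imp_le order_antisym)+
    qed (use Min_in[OF B] in auto)
  qed
  have "\<exists>x\<in>S. c x = Suc n" for n
  proof (induction n)
    case 0
    obtain s where "s \<in> S" using unbounded by blast
    let ?B = "{z \<in> S. z \<le> s}"
    have B: "finite ?B" "?B \<noteq> {}" using fin \<open>s \<in> S\<close> by auto
    have "{z \<in> S. z \<le> Min ?B} = {Min ?B}"
      using Min_in[OF B] Min_le[OF B(1)] by (auto intro: order_antisym)
    thus ?case using Min_in[OF B] by (intro bexI[of _ "Min ?B"]) (auto simp: c_def)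
  next
    case (Suc n)
    then obtain x where "x \<in> S" "c x = Suc n" by blast
    moreover obtain y where "y \<in> S" "x < y" "{z \<in> S. z \<le> y} = insert y {z \<in> S. z \<le> x}"
      using next_elem by blast
    ultimately show ?case using fin[of x] by (intro bexI[of _ y]) (auto simp: c_def)
  qed
  then obtain a where a: "\<And>n. a n \<in> S" "\<And>n. c (a n) = Suc n" by metis
  have "strict_mono a"
    by (rule strict_monoI) (metis a(2) c_le not_le Suc_less_eq)
  moreover have "range a = S"
  proof (intro equalityI subsetI)
    fix s assume "s \<in> S"
    hence "c s > 0" unfolding c_def using fin[of s] by (auto simp: card_gt_0_iff)
    then obtain n where n: "c s = Suc n" by (cases "c s") auto
    have "s = a n"
    proof (rule ccontr)
      assume "s \<noteq> a n"
      hence "s < a n \<or> a n < s" by auto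
      hence "c s \<noteq> c (a n)" using c_less[of s "a n"] c_less[of "a n" s] a(1)[of n] \<open>s \<in> S\<close> by auto
      thus False using n a(2) by simp
    qed
    thus "s \<in> range a" by simp
  qed (use a in auto)
  ultimately show ?thesis using that a(2) by (simp add: c_def)
qed

lemma strict_mono_discrete_at_top:
  fixes a :: "nat \<Rightarrow> real"
  assumes "strict_mono a" "\<And>x. finite {z \<in> range a. z \<le> x}"
  shows "filterlim a at_top sequentially"
  unfolding filterlim_at_top
proof
  fix x
  have "finite (a -` {z \<in> range a. z \<le> x})"
    using assms by (intro finite_vimageI strict_mono_imp_inj_on) auto
  then obtain N where N: "\<forall>n\<in>a -` {z \<in> range a. z \<le> x}. n \<le> N" by (meson finite_nat_set_iff_bounded_le)
  show "eventually (\<lambda>n. x \<le> a n) sequentially"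
    using eventually_gt_at_top[of N] by eventually_elim (use N in \<open>force simp: not_le[symmetric]\<close>)
qed

text \<open>Squaring embeds the zeros up to \<open>x\<close> into the zeros of a nonconstant entire
  function in a compact disc, of which there are finitely many.\<close>

lemma bessel_J_zeros:
  assumes \<nu>: "\<nu> > -1"
  shows "finite {z \<in> {z. 0 < z \<and> bessel_J \<nu> z = 0}. z \<le> x}"
    and "\<exists>z\<in>{z. 0 < z \<and> bessel_J \<nu> z = 0}. x < z"
proof -
  let ?S = "{z \<in> {z. 0 < z \<and> bessel_J \<nu> z = 0}. z \<le> x}"
  obtain w :: real where w: "bes \<nu> w = 0" using bes_zeros_unbounded[OF \<nu>] by blast
  have "\<not> bes \<nu> constant_on (UNIV :: complex set)"
    using bes_0_nonzero[OF \<nu>, where 'a = complex] bes_of_real[OF \<nu>, of w, where 'a = complex] w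
    unfolding constant_on_def by (metis UNIV_I of_real_0)
  hence "finite {z \<in> cball 0 (x\<^sup>2). bes \<nu> (z :: complex) = 0}"
    by (intro holomorphic_compact_finite_zeros[OF holomorphic_on_bes[OF \<nu>], of UNIV]) auto
  moreover have "(\<lambda>z. of_real (z\<^sup>2)) ` ?S \<subseteq> {z \<in> cball 0 (x\<^sup>2). bes \<nu> (z :: complex) = 0}"
    using \<nu> by (auto simp: bessel_J_zero_iff bes_of_real norm_power power_mono simp flip: of_real_power)
  moreover have "inj_on (\<lambda>z. of_real (z\<^sup>2) :: complex) ?S"
    by (rule inj_onI) (auto simp del: of_real_power)
  ultimately show "finite ?S" using finite_imageD finite_subset by blast
  obtain v :: real where v: "v > x\<^sup>2" "bes \<nu> v = 0" using bes_zeros_unbounded[OF \<nu>] by blast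
  hence "0 < v" using zero_le_power2[of x] by linarith
  moreover have "x < sqrt v" using v(1) by (rule real_less_rsqrt)
  ultimately show "\<exists>z\<in>{z. 0 < z \<and> bessel_J \<nu> z = 0}. x < z"
    using v(2) \<nu> by (intro bexI[of _ "sqrt v"]) (auto simp: bessel_J_zero_iff)
qed

text \<open>The count determines the zero, so the definite description has a unique solution. Zeros
  are numbered from 1, hence \<open>Suc m\<close>.\<close>

lemma bessel_zero_enumerates:
  assumes \<nu>: "\<nu> > -1"
  shows "strict_mono (\<lambda>m. bessel_zero \<nu> (Suc m))"
    and "range (\<lambda>m. bessel_zero \<nu> (Suc m)) = {z. 0 < z \<and> bessel_J \<nu> z = 0}"
    and "filterlim (\<lambda>m. bessel_zero \<nu> (Suc m)) at_top sequentially"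
proof -
  let ?S = "{z. 0 < z \<and> bessel_J \<nu> z = 0}"
  obtain a where a: "strict_mono a" "range a = ?S" "\<And>m. card {z \<in> ?S. z \<le> a m} = Suc m"
    using discrete_set_enumeration[of ?S] bessel_J_zeros[OF \<nu>] by blast
  have "bessel_zero \<nu> (Suc m) = a m" for m
    unfolding bessel_zero_def
  proof (rule the_equality)
    have S: "{z. 0 < z \<and> z \<le> x \<and> bessel_J \<nu> z = 0} = {z \<in> ?S. z \<le> x}" for x by auto
    have "a m \<in> ?S" using a(2) by blast
    thus "0 < a m \<and> bessel_J \<nu> (a m) = 0 \<and> card {z. 0 < z \<and> z \<le> a m \<and> bessel_J \<nu> z = 0} = Suc m"
      unfolding S using a(3)[of m] by simp
    fix x assume x: "0 < x \<and> bessel_J \<nu> x = 0 \<and> card {z. 0 < z \<and> z \<le> x \<and> bessel_J \<nu> z = 0} = Suc m"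
    then obtain k where k: "x = a k" using a(2) by blast
    with x have "Suc k = Suc m" unfolding S using a(3)[of k] by simp
    thus "x = a m" using k by simp
  qed
  hence eq: "(\<lambda>m. bessel_zero \<nu> (Suc m)) = a" by auto
  show "strict_mono (\<lambda>m. bessel_zero \<nu> (Suc m))" "range (\<lambda>m. bessel_zero \<nu> (Suc m)) = ?S"
    unfolding eq using a by auto
  show "filterlim (\<lambda>m. bessel_zero \<nu> (Suc m)) at_top sequentially"
    unfolding eq using bessel_J_zeros(1)[OF \<nu>] a(1,2) by (intro strict_mono_discrete_at_top) auto
qed

section \<open>The polynomials\<close>

lemma eval_py_simps [simp]:
  "eval_py 0 p y = 0" "eval_py 1 p y = 1"
  "eval_py (P + Q) p y = eval_py P p y + eval_py Q p y"
  "eval_py (P - Q) p y = eval_py P p y - eval_py Q p y"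
  "eval_py (P * Q) p y = eval_py P p y * eval_py Q p y"
  "eval_py (- P) p y = - eval_py P p y"
  "eval_py (smult c P) p y = poly c p * eval_py P p y"
  "eval_py (pCons c P) p y = poly c p + y * eval_py P p y"
  by (simp_all add: eval_py_def)

lemma eval_py_sum [simp]: "eval_py (sum f A) p y = (\<Sum>i\<in>A. eval_py (f i) p y)"
  by (induction A rule: infinite_finite_induct) simp_all

lemma eval_py_power [simp]: "eval_py (P ^ k) p y = eval_py P p y ^ k"
  by (induction k) simp_all

lemma eval_py_of_nat [simp]: "eval_py (of_nat k) p y = of_nat k"
  by (induction k) simp_all

lemma eval_py_reflect:
  "eval_py (map_poly (\<lambda>c. pcompose c [:0, - 1:]) P) p y = eval_py P (- p) y"
  by (induction P) (simp_all add: map_poly_pCons poly_pcompose)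

lemma eval_F: "eval_py (F k) p y = (- 1) ^ k * p + y * eval_py (E k) (- p) y"
  by (simp add: F_def eval_py_reflect)

lemma eval_E_Suc:
  assumes "k \<ge> 1"
  shows "(real k + 1) * eval_py (E (Suc k)) p y =
    y * (\<Sum>j = 1..k - 1. eval_py (E j) p y * eval_py (E (k - j)) p y)
    + y * (\<Sum>j = 1..k - 2. eval_py (E j) p y * eval_py (E (k - 1 - j)) p y)
    - (real k + p + 1) * eval_py (E k) p y"
  using assms by (simp add: divide_simps distrib_left)

section \<open>From the Riccati recurrence to the polynomials F\<close>

text \<open>The two mixed sums agree under j -> n - j and merge into one alternating sum; the
  alternating sums of adjacent indices will cancel later.\<close>

lemma convolution_expand:
  fixes e :: "nat \<Rightarrow> real"
  shows "(\<Sum>j\<le>n. ((- 1) ^ j * p + y * e j) * ((- 1) ^ (n - j) * p + y * e (n - j)))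
    = (- 1) ^ n * (real n + 1) * p\<^sup>2 + 2 * p * y * (\<Sum>j\<le>n. (- 1) ^ (n - j) * e j)
      + y\<^sup>2 * (\<Sum>j\<le>n. e j * e (n - j))"
proof -
  have "(\<Sum>j\<le>n. ((- 1) ^ j * p + y * e j) * ((- 1) ^ (n - j) * p + y * e (n - j)))
     = (\<Sum>j\<le>n. (- 1) ^ n * p\<^sup>2 + p * y * ((- 1) ^ (n - j) * e j) + p * y * ((- 1) ^ j * e (n - j))
         + y\<^sup>2 * (e j * e (n - j)))"
  proof (rule sum.cong[OF refl])
    fix j assume "j \<in> {..n}"
    hence "(- 1 :: real) ^ n = (- 1) ^ j * (- 1) ^ (n - j)" by (simp flip: power_add)
    thus "((- 1) ^ j * p + y * e j) * ((- 1) ^ (n - j) * p + y * e (n - j))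
      = (- 1) ^ n * p\<^sup>2 + p * y * ((- 1) ^ (n - j) * e j) + p * y * ((- 1) ^ j * e (n - j))
         + y\<^sup>2 * (e j * e (n - j))"
      by (simp add: algebra_simps power2_eq_square)
  qed
  moreover have "(\<Sum>j\<le>n. (- 1) ^ j * e (n - j)) = (\<Sum>j\<le>n. (- 1) ^ (n - j) * e j)"
    by (rule sum.reindex_bij_witness[of _ "\<lambda>j. n - j" "\<lambda>j. n - j"]) auto
  moreover have "(\<Sum>j\<le>n. (- 1) ^ n * p\<^sup>2 + p * y * ((- 1) ^ (n - j) * e j) + p * y * ((- 1) ^ j * e (n - j))
         + y\<^sup>2 * (e j * e (n - j)))
     = real (Suc n) * ((- 1) ^ n * p\<^sup>2) + p * y * (\<Sum>j\<le>n. (- 1) ^ (n - j) * e j)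
       + p * y * (\<Sum>j\<le>n. (- 1) ^ j * e (n - j)) + y\<^sup>2 * (\<Sum>j\<le>n. e j * e (n - j))"
    by (simp only: sum.distrib sum_distrib_left sum_constant card_atMost)
  ultimately show ?thesis by (simp only: of_nat_Suc) (simp only: algebra_simps)
qed

text \<open>After multiplication by a power of \<open>y\<close> the recurrence is homogeneous in the
  scaled coefficients. The ansatz (-1)^k p + y e_k turns it into the recurrence of \<open>E\<close>
  with the sign of \<open>p\<close> reversed, whence the reflection in \<open>F\<close>.\<close>

lemma riccati_coefficients_eq_F:
  fixes \<beta> :: "nat \<Rightarrow> real"
  assumes "y \<noteq> 0" and \<beta>0: "\<beta> 0 = p / y"
    and \<beta>1: "y * \<beta> 1 = y * (\<beta> 0)\<^sup>2 - (p + 1) * \<beta> 0 + 1 / 4"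
    and \<beta>_rec: "\<And>k. k \<ge> 1 \<Longrightarrow> y * ((real k + 1) * \<beta> (Suc k)) + real k * \<beta> k =
      y * (\<Sum>j\<le>k. \<beta> j * \<beta> (k - j)) + (\<Sum>j\<le>k - 1. \<beta> j * \<beta> (k - 1 - j)) - (p + 1) * \<beta> k"
    and "k \<ge> 1"
  shows "y ^ (k + 1) * \<beta> k = eval_py (F k) p y"
proof -
  define \<gamma> where "\<gamma> = (\<lambda>k. y ^ (k + 1) * \<beta> k)"
  define e where "e = (\<lambda>k. eval_py (E k) (- p) y)"
  \<comment> \<open>The dummy value \<open>E 0 = 0\<close> makes the ansatz correct at index 0,
    where the scaled coefficient is \<open>p\<close>, and lets the full convolutions below shrink to
    the ranges in \<open>E\<close>.\<close>
  have e0: "e 0 = 0" and e1: "e (Suc 0) = 1 / 4" by (simp_all add: e_def)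
  have conv\<gamma>: "y ^ (n + 2) * (\<Sum>j\<le>n. \<beta> j * \<beta> (n - j)) = (\<Sum>j\<le>n. \<gamma> j * \<gamma> (n - j))" for n
    unfolding sum_distrib_left
  proof (rule sum.cong[OF refl])
    fix j assume "j \<in> {..n}"
    hence eq: "y ^ (n + 2) = y ^ (j + 1) * y ^ (n - j + 1)" by (simp flip: power_add)
    show "y ^ (n + 2) * (\<beta> j * \<beta> (n - j)) = \<gamma> j * \<gamma> (n - j)"
      unfolding \<gamma>_def eq by (simp only: mult_ac)
  qed
  have main: "\<gamma> k = (- 1) ^ k * p + y * e k" for k
  proof (induction k rule: less_induct)
    case (less k)
    consider "k = 0" | "k = 1" | l where "k = Suc l" "l \<ge> 1" by (metis One_nat_def Suc_leI gr0I not0_implies_Suc)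
    thus ?case
    proof cases
      case 1
      thus ?thesis using \<beta>0 \<open>y \<noteq> 0\<close> by (simp add: \<gamma>_def e0)
    next
      case 2
      have "\<gamma> k = y * (y * \<beta> 1)" by (simp add: \<gamma>_def 2)
      also have "\<dots> = - p + y * (1 / 4)"
        unfolding \<beta>1 \<beta>0 using \<open>y \<noteq> 0\<close> by (simp add: field_simps power2_eq_square)
      finally show ?thesis using 2 e1 by simp
    next
      case 3
      define Alt where "Alt = (\<lambda>n. \<Sum>j\<le>n. (- 1) ^ (n - j) * e j)"
      define C where "C = (\<lambda>n. \<Sum>j\<le>n. e j * e (n - j))"
      obtain i where i: "l = Suc i" using 3 by (cases l) auto
      have conv: "(\<Sum>j\<le>n. \<gamma> j * \<gamma> (n - j)) = (- 1) ^ n * (real n + 1) * p\<^sup>2 + 2 * p * y * Alt n + y\<^sup>2 * C n"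
        if "n \<le> l" for n
        unfolding Alt_def C_def convolution_expand[symmetric]
        by (rule sum.cong[OF refl]) (use that less.IH 3 in auto)
      \<comment> \<open>Thus the alternating sums for \<open>l\<close> and its predecessor
        \<open>i\<close> add up to \<open>e l\<close> alone.\<close>
      have Alt: "Alt l = e l - Alt i"
        unfolding Alt_def i by (simp add: sum_negf[symmetric] Suc_diff_le)
      have C_l: "C l = (\<Sum>j = 1..l - 1. e j * e (l - j))"
        unfolding C_def i by (rule sum.mono_neutral_right) (auto simp: e0 not_le le_Suc_eq Suc_le_eq)
      have C_i: "C i = (\<Sum>j = 1..l - 2. e j * e (l - 1 - j))"
        unfolding C_def i by (simp, rule sum.mono_neutral_right) (auto simp: e0 not_le Suc_le_eq dest: le_antisym)
      have e_rec: "(real l + 1) * e (Suc l) = y * C l + y * C i - (real l - p + 1) * e l"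
        using eval_E_Suc[OF 3(2), of "- p" y] unfolding C_l C_i by (simp add: e_def del: E.simps(2))
      have \<gamma>_l: "\<gamma> l = (- 1) ^ l * p + y * e l" using less.IH[of l] 3 by simp
      have "(real l + 1) * \<gamma> (Suc l) = y ^ (l + 1) * (y * ((real l + 1) * \<beta> (Suc l)))"
        by (simp add: \<gamma>_def)
      also have "\<dots> = y ^ (l + 2) * (\<Sum>j\<le>l. \<beta> j * \<beta> (l - j)) + y ^ (i + 2) * (\<Sum>j\<le>i. \<beta> j * \<beta> (i - j))
          - (real l + p + 1) * \<gamma> l"
        using arg_cong[OF \<beta>_rec[OF 3(2)], of "\<lambda>t. y ^ (l + 1) * t"] by (simp add: i \<gamma>_def algebra_simps)
      also have "\<dots> = (- 1) ^ l * (real l + 1) * p\<^sup>2 + 2 * p * y * Alt l + y\<^sup>2 * C l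
          + ((- 1) ^ i * (real i + 1) * p\<^sup>2 + 2 * p * y * Alt i + y\<^sup>2 * C i) - (real l + p + 1) * \<gamma> l"
        unfolding conv\<gamma> using conv[of l] conv[of i] i by simp
      \<comment> \<open>The two quadratic terms in \<open>p\<close> add up to (-1)^l p^2, which the
        product of -p and the first part of \<open>\<gamma> l\<close> cancels; the mixed terms 2 p y
        e_l - p y e_l turn l + p + 1 into l - p + 1.\<close>
      also have "\<dots> = (real l + 1) * ((- 1) ^ Suc l * p) + y * (y * C l + y * C i - (real l - p + 1) * e l)"
        unfolding Alt \<gamma>_l by (simp add: i algebra_simps power2_eq_square)
      also have "\<dots> = (real l + 1) * ((- 1) ^ Suc l * p + y * e (Suc l))"
        unfolding e_rec[symmetric] by (simp only: algebra_simps)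
      finally show ?thesis using 3(1) by simp
    qed
  qed
  show ?thesis using main[of k] by (simp add: \<gamma>_def e_def eval_F)
qed

section \<open>Weighted degrees and the top-weight parts of E\<close>

text \<open>Zero coefficients are exempt: as \<open>degree 0 = 0\<close>, they would otherwise force
  \<open>2 * i \<le> w\<close> for every \<open>i\<close>.\<close>

definition weight_le :: "nat \<Rightarrow> real poly poly \<Rightarrow> bool" where
  "weight_le w P \<longleftrightarrow> (\<forall>i. coeff P i \<noteq> 0 \<longrightarrow> degree (coeff P i) + 2 * i \<le> w)"

text \<open>The coefficient of p^(w - 2i) y^i, a monomial of weight exactly \<open>w\<close>; the
  guard protects against truncated subtraction.\<close>

definition top_part :: "nat \<Rightarrow> real poly poly \<Rightarrow> nat \<Rightarrow> real" where
  "top_part w P i = (if 2 * i \<le> w then coeff (coeff P i) (w - 2 * i) else 0)"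

lemma weight_leD:
  assumes "weight_le w P"
  shows "degree (coeff P i) \<le> w - 2 * i" and "2 * i > w \<Longrightarrow> coeff P i = 0"
  using assms unfolding weight_le_def by (cases "coeff P i = 0"; force)+

lemma weight_leI:
  assumes "\<And>i. 2 * i \<le> w \<Longrightarrow> degree (coeff P i) \<le> w - 2 * i" and "\<And>i. 2 * i > w \<Longrightarrow> coeff P i = 0"
  shows "weight_le w P"
  unfolding weight_le_def using assms by (metis le_diff_conv2 not_le)

lemma weight_le_0: "weight_le w 0"
  by (simp add: weight_le_def)

lemma weight_le_mono: "weight_le v P \<Longrightarrow> v \<le> w \<Longrightarrow> weight_le w P"
  unfolding weight_le_def by (meson order_trans)

lemma weight_le_add: "weight_le w P \<Longrightarrow> weight_le w Q \<Longrightarrow> weight_le w (P + Q)"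
  using weight_leD by (intro weight_leI) (auto intro: degree_add_le)

lemma weight_le_diff: "weight_le w P \<Longrightarrow> weight_le w Q \<Longrightarrow> weight_le w (P - Q)"
  using weight_leD by (intro weight_leI) (auto intro: degree_diff_le)

lemma weight_le_sum: "(\<And>j. j \<in> A \<Longrightarrow> weight_le w (f j)) \<Longrightarrow> weight_le w (sum f A)"
  by (induction A rule: infinite_finite_induct) (auto intro: weight_le_add weight_le_0)

lemma weight_le_smult: "weight_le w P \<Longrightarrow> weight_le w (smult [:c:] P)"
  using weight_leD by (intro weight_leI) (auto intro: order_trans[OF degree_smult_le])

lemma weight_le_mult:
  assumes "weight_le v P" "weight_le w Q"
  shows "weight_le (v + w) (P * Q)"
proof (rule weight_leI)
  fix i
  have deg: "coeff P l * coeff Q (i - l) = 0 \<or> degree (coeff P l * coeff Q (i - l)) + 2 * i \<le> v + w" if "l \<le> i" for l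
  proof (cases "coeff P l = 0 \<or> coeff Q (i - l) = 0")
    case False
    hence "degree (coeff P l) + 2 * l \<le> v" "degree (coeff Q (i - l)) + 2 * (i - l) \<le> w"
      using assms unfolding weight_le_def by blast+
    thus ?thesis using False that by (simp add: degree_mult_eq)
  qed auto
  show "degree (coeff (P * Q) i) \<le> v + w - 2 * i" if "2 * i \<le> v + w"
    unfolding coeff_mult using deg that by (intro degree_sum_le) fastforce+
  show "coeff (P * Q) i = 0" if "2 * i > v + w"
    unfolding coeff_mult using deg that by (intro sum.neutral) fastforce
qed

lemma weight_le_indet_y: "weight_le 2 indet_y"
  by (rule weight_leI) (auto simp: coeff_pCons split: nat.splits)

lemma weight_le_linear: "weight_le 1 (of_nat k + indet_p + 1)"
proof (rule weight_leI)
  fix i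
  show "degree (coeff (of_nat k + indet_p + 1) i) \<le> 1 - 2 * i" if "2 * i \<le> 1"
    using that by (cases i) (simp_all add: of_nat_poly one_pCons)
  show "coeff (of_nat k + indet_p + 1) i = 0" if "2 * i > 1"
    using that by (cases i) (simp_all add: of_nat_poly one_pCons)
qed

text \<open>Multiplicativity of leading coefficients under mere degree bounds: if a bound is not
  attained, both sides are 0.\<close>

lemma coeff_mult_degree_bound:
  fixes a b :: "real poly"
  assumes "degree a \<le> m" "degree b \<le> n"
  shows "coeff (a * b) (m + n) = coeff a m * coeff b n"
proof (cases "degree a = m \<and> degree b = n")
  case True
  thus ?thesis using coeff_mult_degree_sum[of a b] by auto
next
  case False
  hence "coeff a m * coeff b n = 0" using assms by (auto simp: coeff_eq_0)
  moreover have "degree (a * b) < m + n" using False assms degree_mult_le[of a b] by linarith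
  ultimately show ?thesis by (simp add: coeff_eq_0)
qed

lemma top_part_simps:
  "top_part w (P + Q) i = top_part w P i + top_part w Q i"
  "top_part w (P - Q) i = top_part w P i - top_part w Q i"
  "top_part w (sum f A) i = (\<Sum>j\<in>A. top_part w (f j) i)"
  "top_part w (smult [:c:] P) i = c * top_part w P i"
  by (simp_all add: top_part_def coeff_sum)

text \<open>Passing to the part of top weight is multiplicative, so top parts convolve like
  coefficients of polynomials in \<open>y\<close> alone.\<close>

lemma top_part_mult:
  assumes "weight_le v P" "weight_le w Q"
  shows "top_part (v + w) (P * Q) i = (\<Sum>l\<le>i. top_part v P l * top_part w Q (i - l))"
proof -
  have "(if 2 * i \<le> v + w then coeff (coeff P l * coeff Q (i - l)) (v + w - 2 * i) else 0)
      = top_part v P l * top_part w Q (i - l)" if "l \<le> i" for l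
  proof (cases "2 * l \<le> v \<and> 2 * (i - l) \<le> w")
    case True
    hence eq: "v + w - 2 * i = (v - 2 * l) + (w - 2 * (i - l))" using that by linarith
    have "2 * i \<le> v + w" using True that by linarith
    thus ?thesis
      using True weight_leD(1)[OF assms(1), of l] weight_leD(1)[OF assms(2), of "i - l"]
      unfolding top_part_def eq by (simp only: coeff_mult_degree_bound if_True)
  next
    case False
    thus ?thesis using weight_leD(2)[OF assms(1), of l] weight_leD(2)[OF assms(2), of "i - l"]
      by (auto simp: top_part_def)
  qed
  moreover have "top_part (v + w) (P * Q) i
      = (\<Sum>l\<le>i. if 2 * i \<le> v + w then coeff (coeff P l * coeff Q (i - l)) (v + w - 2 * i) else 0)"
    by (simp add: top_part_def coeff_mult[of P Q] coeff_sum)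
  ultimately show ?thesis by simp
qed

lemma top_part_eq_0:
  assumes "weight_le v P" "v < w"
  shows "top_part w P i = 0"
proof -
  have "degree (coeff P i) < w - 2 * i \<or> coeff P i = 0" if "2 * i \<le> w"
    using assms that unfolding weight_le_def by (metis add_less_cancel_right le_add_diff_inverse2 le_less_trans)
  thus ?thesis by (auto simp: top_part_def coeff_eq_0)
qed

text \<open>In the step to \<open>E (Suc l)\<close> the first sum has weight 2 + (j - 1) + (l - j -
  1) = l, the second one less, and the linear factor raises the weight l - 1 of \<open>E l\<close>
  by one.\<close>

lemma weight_le_E: "weight_le (k - 1) (E k)"
proof (induction k rule: less_induct)
  case (less k)
  consider "k = 0" | "k = 1" | l where "k = Suc l" "l \<ge> 1" by (metis One_nat_def Suc_leI gr0I not0_implies_Suc)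
  thus ?case
  proof cases
    case 3
    have "weight_le l (indet_y * (E j * E (l - j)))" if "j \<in> {1..l - 1}" for j
      by (rule weight_le_mono[OF weight_le_mult[OF weight_le_indet_y weight_le_mult[OF less.IH less.IH]]])
        (use that 3 in auto)
    moreover have "weight_le l (indet_y * (E j * E (l - 1 - j)))" if "j \<in> {1..l - 2}" for j
      by (rule weight_le_mono[OF weight_le_mult[OF weight_le_indet_y weight_le_mult[OF less.IH less.IH]]])
        (use that 3 in auto)
    moreover have "weight_le l ((of_nat l + indet_p + 1) * E l)"
      using weight_le_mult[OF weight_le_linear[of l] less.IH[of l]] 3 by simp
    ultimately show ?thesis using 3
      by (auto simp: sum_distrib_left simp del: mult_pCons_left
          intro!: weight_le_smult weight_le_diff weight_le_add weight_le_sum)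
  qed (auto simp: weight_le_0 weight_le_def coeff_pCons split: nat.splits)
qed

text \<open>In top weight the second sum of the recurrence is invisible and the linear factor
  reduces to \<open>p\<close>. The factor \<open>y\<close> costs two units of weight and one
  index.\<close>

lemma top_part_E_Suc:
  assumes "l \<ge> 1"
  shows "(real l + 1) * top_part l (E (Suc l)) i =
    (\<Sum>j = 1..l - 1. if i = 0 then 0 else top_part (l - 2) (E j * E (l - j)) (i - 1)) - top_part (l - 1) (E l) i"
proof -
  \<comment> \<open>For \<open>l = 1\<close>, where \<open>l - 2\<close> would be truncated, the
    sums over \<open>j\<close> are empty.\<close>
  have y: "top_part l (indet_y * P) i = (if i = 0 then 0 else top_part (l - 2) P (i - 1))" if "l \<ge> 2" for P
    using that by (cases i) (auto simp: top_part_def coeff_pCons)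
  have lin: "top_part l ((of_nat l + indet_p + 1) * E l) i = top_part (l - 1) (E l) i"
  proof -
    have eq: "top_part 1 (of_nat l + indet_p + 1) j = (if j = 0 then 1 else 0)" for j
      by (auto simp: top_part_def of_nat_poly one_pCons)
    have "top_part l ((of_nat l + indet_p + 1) * E l) i
        = (\<Sum>j\<le>i. (if j = 0 then 1 else 0) * top_part (l - 1) (E l) (i - j))"
      using top_part_mult[OF weight_le_linear[of l] weight_le_E[of l], of i] assms unfolding eq by simp
    also have "\<dots> = (\<Sum>j\<le>i. if j = 0 then top_part (l - 1) (E l) (i - j) else 0)"
      by (intro sum.cong) auto
    also have "\<dots> = top_part (l - 1) (E l) i" by (subst sum.delta) auto
    finally show ?thesis .
  qed
  have low: "top_part l (indet_y * (E j * E (l - 1 - j))) i = 0" if "j \<in> {1..l - 2}" for j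
    using that weight_le_mult[OF weight_le_indet_y weight_le_mult[OF weight_le_E[of j] weight_le_E[of "l - 1 - j"]]]
    by (intro top_part_eq_0) auto
  have "(real l + 1) * top_part l (E (Suc l)) i =
      (\<Sum>j = 1..l - 1. top_part l (indet_y * (E j * E (l - j))) i)
      + (\<Sum>j = 1..l - 2. top_part l (indet_y * (E j * E (l - 1 - j))) i)
      - top_part l ((of_nat l + indet_p + 1) * E l) i"
    using assms by (simp add: top_part_simps sum_distrib_left del: mult_pCons_left)
  also have "(\<Sum>j = 1..l - 2. top_part l (indet_y * (E j * E (l - 1 - j))) i) = 0"
    using low by (intro sum.neutral) blast
  also have "(\<Sum>j = 1..l - 1. top_part l (indet_y * (E j * E (l - j))) i)
      = (\<Sum>j = 1..l - 1. if i = 0 then 0 else top_part (l - 2) (E j * E (l - j)) (i - 1))"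
    by (intro sum.cong refl y) auto
  finally show ?thesis unfolding lin by simp
qed

text \<open>With the sign (-1)^(k-1) built in, the top-weight recurrence adds only nonnegative
  terms, so nothing cancels and one positive term suffices.\<close>

lemma top_part_E_sign:
  assumes "k \<ge> 1" "2 * i \<le> k - 1"
  shows "(- 1) ^ (k - 1) * top_part (k - 1) (E k) i > 0"
  using assms
proof (induction k arbitrary: i rule: less_induct)
  case (less k)
  consider "k = 1" | l where "k = Suc l" "l \<ge> 1" using less.prems by (metis not_one_le_zero One_nat_def Suc_leI gr0I not0_implies_Suc)
  thus ?case
  proof cases
    case 1
    thus ?thesis using less.prems by (simp add: top_part_def)
  next
    case 2
    have nonneg: "0 \<le> (- 1) ^ (j - 1) * top_part (j - 1) (E j) i" if "1 \<le> j" "j < k" for j i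
      using less.IH[of j i] that by (cases "2 * i \<le> j - 1") (auto simp: top_part_def)
    define c where "c = (\<lambda>j. if i = 0 then 0 else (- 1) ^ (l - 2) * top_part (l - 2) (E j * E (l - j)) (i - 1))"
    have c: "c j = (\<Sum>m\<le>i - 1. ((- 1) ^ (j - 1) * top_part (j - 1) (E j) m)
          * ((- 1) ^ (l - j - 1) * top_part (l - j - 1) (E (l - j)) (i - 1 - m)))"
      if "j \<in> {1..l - 1}" "i \<noteq> 0" for j
    proof -
      have l2: "l - 2 = (j - 1) + (l - j - 1)" using that by auto
      show ?thesis
        unfolding c_def l2 top_part_mult[OF weight_le_E[of j] weight_le_E[of "l - j"]] power_add
        using that by (simp add: sum_distrib_left mult_ac)
    qed
    have c_nonneg: "0 \<le> c j" if "j \<in> {1..l - 1}" for j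
    proof (cases "i = 0")
      case False
      show ?thesis unfolding c[OF that False]
        by (intro sum_nonneg mult_nonneg_nonneg nonneg) (use that 2 in auto)
    qed (simp add: c_def)
    have "(real l + 1) * ((- 1) ^ l * top_part l (E (Suc l)) i)
        = (- 1) ^ l * ((real l + 1) * top_part l (E (Suc l)) i)" by simp
    also have "\<dots> = (\<Sum>j = 1..l - 1. c j) + (- 1) ^ (l - 1) * top_part (l - 1) (E l) i"
    proof -
      have "(- 1) ^ l * (if i = 0 then 0 else top_part (l - 2) (E j * E (l - j)) (i - 1)) = c j"
        if "j \<in> {1..l - 1}" for j
      proof -
        have "(- 1 :: real) ^ l = (- 1) ^ (l - 2 + 2)" using that by (intro arg_cong[of _ _ "\<lambda>n. (- 1) ^ n"]) auto
        thus ?thesis by (simp add: c_def)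
      qed
      moreover have "(- 1 :: real) ^ l = - ((- 1) ^ (l - 1))" using 2 by (cases l) auto
      ultimately show ?thesis unfolding top_part_E_Suc[OF 2(2)] right_diff_distrib sum_distrib_left
        by simp
    qed
    also have "\<dots> > 0"
    proof (cases "2 * i \<le> l - 1")
      case True
      thus ?thesis using less.IH[of l i] 2 c_nonneg by (intro add_nonneg_pos sum_nonneg) auto
    next
      case False
      \<comment> \<open>Here the monomial is out of reach of \<open>E l\<close>, which has weight
        \<open>l - 1\<close>; the positive term is the product of \<open>E 1\<close> and the highest
        \<open>y\<close>-power in \<open>E (l - 1)\<close>.\<close>
      hence i: "2 * i = l" "i \<noteq> 0" using less.prems 2 by auto
      have "0 < ((- 1) ^ (1 - 1 :: nat) * top_part (1 - 1) (E 1) 0)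
          * ((- 1) ^ (l - 1 - 1) * top_part (l - 1 - 1) (E (l - 1)) (i - 1 - 0))"
        by (intro mult_pos_pos less.IH) (use i 2 in auto)
      also have "\<dots> \<le> c 1"
      proof -
        define f where "f = (\<lambda>m. ((- 1) ^ (1 - 1 :: nat) * top_part (1 - 1) (E 1) m)
          * ((- 1) ^ (l - 1 - 1) * top_part (l - 1 - 1) (E (l - 1)) (i - 1 - m)))"
        have "0 \<le> f m" for m
          unfolding f_def by (intro mult_nonneg_nonneg nonneg) (use i 2 in auto)
        hence "f 0 \<le> (\<Sum>m\<le>i - 1. f m)" by (intro member_le_sum) auto
        moreover have "1 \<in> {1..l - 1}" using i by auto
        ultimately show ?thesis using c[of 1, OF _ i(2)] by (simp only: f_def)
      qed
      also have "\<dots> \<le> (\<Sum>j = 1..l - 1. c j)"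
        using i c_nonneg by (intro member_le_sum) auto
      finally show ?thesis using nonneg[of l i] 2 by simp
    qed
    finally show ?thesis using 2 by (simp add: zero_less_mult_iff)
  qed
qed

lemma degree_E: "degree (E k) = (k - 1) div 2" if "k \<ge> 1"
proof (rule antisym)
  show "degree (E k) \<le> (k - 1) div 2"
    by (rule degree_le) (use weight_leD(2)[OF weight_le_E[of k]] in auto)
  have "top_part (k - 1) (E k) ((k - 1) div 2) \<noteq> 0"
    using top_part_E_sign[OF that, of "(k - 1) div 2"] by auto
  thus "(k - 1) div 2 \<le> degree (E k)"
    by (intro le_degree) (auto simp: top_part_def split: if_splits)
qed

lemma degree_coeff_E_0: "degree (coeff (E k) 0) = k - 1" if "k \<ge> 1"
proof (rule antisym)
  show "degree (coeff (E k) 0) \<le> k - 1"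
    using weight_leD(1)[OF weight_le_E[of k], of 0] by simp
  show "k - 1 \<le> degree (coeff (E k) 0)"
    using top_part_E_sign[OF that, of 0] by (intro le_degree) (auto simp: top_part_def)
qed

lemma coeff_F_0: "coeff (F k) 0 = smult ((- 1) ^ k) [:0, 1:]"
  by (cases "even k") (simp_all add: F_def)

lemma coeff_F_Suc: "coeff (F k) (Suc i) = pcompose (coeff (E k) i) [:0, - 1:]"
  by (cases "even k") (simp_all add: F_def coeff_map_poly)

text \<open>The factor \<open>y\<close> raises the degree of \<open>E k\<close> by one, and p -> -p
  annihilates no coefficient.\<close>

lemma degree_F: "degree (F k) = 1 + (k - 1) div 2" if k: "k \<ge> 1"
proof (rule antisym)
  show "degree (F k) \<le> 1 + (k - 1) div 2"
  proof (rule degree_le, intro allI impI)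
    fix i assume "i > 1 + (k - 1) div 2"
    then obtain j where "i = Suc j" "j > degree (E k)" using degree_E[OF k] by (cases i) auto
    thus "coeff (F k) i = 0" by (simp add: coeff_F_Suc coeff_eq_0)
  qed
  have "top_part (k - 1) (E k) ((k - 1) div 2) \<noteq> 0"
    using top_part_E_sign[OF that, of "(k - 1) div 2"] by auto
  hence "coeff (E k) ((k - 1) div 2) \<noteq> 0" by (auto simp: top_part_def split: if_splits)
  hence "coeff (F k) (Suc ((k - 1) div 2)) \<noteq> 0" by (auto simp: coeff_F_Suc pcompose_eq_0)
  thus "1 + (k - 1) div 2 \<le> degree (F k)" by (intro le_degree) simp
qed

text \<open>The term free of \<open>y\<close> has degree 1 in \<open>p\<close>, the coefficient of
  the first power of \<open>y\<close> has degree \<open>k - 1\<close>, and the weight bound keeps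
  all others below.\<close>

lemma degree_p_F: "degree_p (F k) = max 1 (k - 1)" if "k \<ge> 1"
  unfolding degree_p_def
proof (rule Max_eqI)
  have deg0: "degree (coeff (F k) 0) = 1" by (simp add: coeff_F_0)
  have degS: "degree (coeff (F k) (Suc i)) = degree (coeff (E k) i)" for i
    by (simp add: coeff_F_Suc degree_pcompose)
  show "d \<le> max 1 (k - 1)" if "d \<in> (\<lambda>i. degree (coeff (F k) i)) ` {..degree (F k)}" for d
  proof -
    from that obtain i where i: "d = degree (coeff (F k) i)" by auto
    show ?thesis
    proof (cases i)
      case 0
      thus ?thesis using i deg0 by simp
    next
      case (Suc j)
      thus ?thesis using i degS[of j] weight_leD(1)[OF weight_le_E[of k], of j] by simp
    qed
  qed
  have "max 1 (k - 1) = degree (coeff (F k) 0) \<or> max 1 (k - 1) = degree (coeff (F k) (Suc 0))"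
    unfolding deg0 degS degree_coeff_E_0[OF that] by auto
  moreover have "0 \<in> {..degree (F k)}" "Suc 0 \<in> {..degree (F k)}" by (simp_all add: degree_F[OF that])
  ultimately show "max 1 (k - 1) \<in> (\<lambda>i. degree (coeff (F k) i)) ` {..degree (F k)}" by blast
qed simp

section \<open>Taylor coefficients and power sums\<close>

text \<open>Along the real axis the complex derivative is the derivative of a real-valued function,
  so its imaginary part vanishes and its real part is the real derivative.\<close>

lemma higher_deriv_of_real:
  fixes f :: "complex \<Rightarrow> complex" and g :: "real \<Rightarrow> real"
  assumes holf: "f holomorphic_on S" and "open S" and "of_real x \<in> S"
    and eq: "\<And>y. of_real y \<in> S \<Longrightarrow> f (of_real y) = of_real (g y)"
  shows "(deriv ^^ k) f (of_real x) = of_real ((deriv ^^ k) g x)"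
  using assms(3)
proof (induction k arbitrary: x)
  case 0
  thus ?case by (simp add: eq)
next
  case (Suc k)
  define d where "d = (deriv ^^ Suc k) f (of_real x)"
  have "((deriv ^^ k) f has_field_derivative d) (at (of_real x))"
    unfolding d_def using holomorphic_derivI[OF holomorphic_higher_deriv[OF holf \<open>open S\<close>] \<open>open S\<close> Suc.prems] by simp
  hence d: "((\<lambda>y. (deriv ^^ k) f (of_real y)) has_vector_derivative d) (at x)"
    by (rule has_vector_derivative_real_field)
  have open_T: "open (of_real -` S :: real set)"
    using \<open>open S\<close> by (intro open_vimage continuous_intros)
  have "((\<lambda>y. Re ((deriv ^^ k) f (of_real y))) has_real_derivative Re d) (at x)"
    using d by (rule has_field_derivative_Re)
  hence "((deriv ^^ k) g has_real_derivative Re d) (at x)"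
    by (rule has_field_derivative_transform_within_open[OF _ open_T]) (use Suc in auto)
  moreover have "((\<lambda>y. Im ((deriv ^^ k) f (of_real y))) has_real_derivative Im d) (at x)"
    using d by (rule has_field_derivative_Im)
  hence "((\<lambda>y. 0) has_real_derivative Im d) (at x)"
    by (rule has_field_derivative_transform_within_open[OF _ open_T]) (use Suc in auto)
  hence "Im d = 0" using DERIV_unique DERIV_const by blast
  ultimately show ?case unfolding d_def[symmetric] by (simp add: DERIV_imp_deriv complex_eq_iff)
qed

lemma bes_logderiv_holomorphic:
  "bes_logderiv p holomorphic_on {z. bes p z \<noteq> (0 :: complex)}" if "p > -1"
  unfolding bes_logderiv_def[abs_def] by (intro holomorphic_intros holomorphic_on_bes) (use that in auto)

lemma open_bes_nonzero: "open {z. bes p z \<noteq> (0 :: complex)}" if "p > -1"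
  using holomorphic_on_imp_continuous_on[OF holomorphic_on_bes[OF that]]
  by (intro open_Collect_neq) auto

lemma higher_deriv_D:
  assumes "p > -1" "x > 0" "bes p x \<noteq> 0"
  shows "(deriv ^^ k) (bes_logderiv p) (of_real x :: complex) = of_real ((deriv ^^ k) (D p) x)"
proof (rule higher_deriv_of_real)
  \<comment> \<open>The half-plane is needed because \<open>D p\<close> agrees with
    \<open>bes_logderiv p\<close> only at positive arguments.\<close>
  let ?S = "{z. bes p z \<noteq> (0 :: complex)} \<inter> {z. 0 < Re z}"
  show "bes_logderiv p holomorphic_on ?S"
    using bes_logderiv_holomorphic[OF assms(1)] by (rule holomorphic_on_subset) auto
  show "open ?S" using open_bes_nonzero[OF assms(1)] open_halfspace_Re_gt[of 0] by (intro open_Int) auto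
  show "of_real x \<in> ?S" using assms by (simp add: bes_of_real)
  show "bes_logderiv p (of_real y) = of_real (D p y)" if "of_real y \<in> ?S" for y
    using that assms(1) by (simp add: D_eq_bes_logderiv bes_logderiv_of_real)
qed

text \<open>The Riccati equation is read as an identity of formal power series around
  \<open>x\<close>; its factor x + X couples adjacent coefficients, and the constant 1/4 enters only
  at index 0.\<close>

lemma bes_riccati_taylor:
  fixes x :: real
  assumes p: "p > -1" and x: "x > 0" "bes p x \<noteq> 0"
  defines "\<beta> \<equiv> \<lambda>k. (deriv ^^ k) (D p) x / fact k"
  shows "x * \<beta> 1 = x * (\<beta> 0)\<^sup>2 - (p + 1) * \<beta> 0 + 1 / 4"
    and "k \<ge> 1 \<Longrightarrow> x * ((real k + 1) * \<beta> (Suc k)) + real k * \<beta> k =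
      x * (\<Sum>j\<le>k. \<beta> j * \<beta> (k - j)) + (\<Sum>j\<le>k - 1. \<beta> j * \<beta> (k - 1 - j)) - (p + 1) * \<beta> k"
proof -
  define z where "z = (of_real x :: complex)"
  define q where "q = (\<lambda>h. bes_logderiv p (z + h))"
  define A where "A = fps_expansion (bes_logderiv p) z"
  have z: "z \<in> {z. bes p z \<noteq> 0}" using assms by (simp add: z_def bes_of_real)
  have A_nth: "fps_nth A k = of_real (\<beta> k)" for k
    unfolding A_def fps_expansion_def \<beta>_def z_def using higher_deriv_D[OF p x] by simp
  have "bes_logderiv p analytic_on {z}"
    using bes_logderiv_holomorphic[OF p] open_bes_nonzero[OF p] z analytic_at by blast
  hence q: "q has_fps_expansion A"
    unfolding q_def A_def by (rule analytic_at_imp_has_fps_expansion)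
  have shift: "(\<lambda>h. z + h) has_fps_expansion (fps_const z + fps_X)"
    by (intro fps_expansion_intros)
  have ev: "eventually (\<lambda>h. (z + h) * deriv q h = (z + h) * (q h * q h) - of_real (p + 1) * q h + 1 / 4) (nhds 0)"
  proof -
    have "eventually (\<lambda>h. z + h \<in> {z. bes p z \<noteq> 0}) (nhds 0)"
    proof -
      have "open ((\<lambda>h. z + h) -` {z. bes p z \<noteq> 0})"
        using open_bes_nonzero[OF p] by (intro open_vimage continuous_intros)
      thus ?thesis using eventually_nhds_in_open[of "(\<lambda>h. z + h) -` {z. bes p z \<noteq> 0}" 0] z by simp
    qed
    thus ?thesis
    proof eventually_elim
      case (elim h)
      then obtain d where d: "(bes_logderiv p has_field_derivative d) (at (z + h))"
        "(z + h) * d = (z + h) * (bes_logderiv p (z + h))\<^sup>2 - of_real (p + 1) * bes_logderiv p (z + h) + 1 / 4"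
        using bes_riccati[OF p, of "z + h"] by blast
      have "deriv q h = d" unfolding q_def
        using d(1) by (intro DERIV_imp_deriv) (simp add: DERIV_shift add.commute)
      thus ?case using d(2) by (simp add: q_def power2_eq_square)
    qed
  qed
  have lhs: "(\<lambda>h. (z + h) * deriv q h) has_fps_expansion (fps_const z + fps_X) * fps_deriv A"
    by (intro fps_expansion_intros shift q)
  have rhs: "(\<lambda>h. (z + h) * (q h * q h) - of_real (p + 1) * q h + 1 / 4) has_fps_expansion
      (fps_const z + fps_X) * (A * A) - fps_const (of_real (p + 1)) * A + fps_const (1 / 4)"
    by (intro fps_expansion_intros shift q)
  have fps: "(fps_const z + fps_X) * fps_deriv A
      = (fps_const z + fps_X) * (A * A) - fps_const (of_real (p + 1)) * A + fps_const (1 / 4)"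
    by (rule fps_expansion_unique_complex[OF lhs has_fps_expansion_cong[OF ev refl, THEN iffD2, OF rhs]])
  have nth: "(if k = 0 then 0 else fps_nth (fps_deriv A) (k - 1)) + z * fps_nth (fps_deriv A) k
      = z * fps_nth (A * A) k + (if k = 0 then 0 else fps_nth (A * A) (k - 1)) - of_real (p + 1) * fps_nth A k
        + (if k = 0 then 1 / 4 else 0)" for k
    using arg_cong[OF fps, of "\<lambda>F. fps_nth F k"]
    by (cases "k = 0") (simp_all add: distrib_right add.commute del: fps_deriv_nth)
  have AA: "fps_nth (A * A) k = of_real (\<Sum>j\<le>k. \<beta> j * \<beta> (k - j))" for k
    by (simp add: fps_mult_nth A_nth atLeast0AtMost)
  have "of_real (x * \<beta> 1) = (of_real (x * (\<beta> 0)\<^sup>2 - (p + 1) * \<beta> 0 + 1 / 4) :: complex)"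
    using nth[of 0] by (simp add: AA A_nth z_def power2_eq_square)
  thus "x * \<beta> 1 = x * (\<beta> 0)\<^sup>2 - (p + 1) * \<beta> 0 + 1 / 4" by (simp only: of_real_eq_iff)
  assume "k \<ge> 1"
  have "(of_real (x * ((real k + 1) * \<beta> (Suc k)) + real k * \<beta> k) :: complex) =
      of_real (x * (\<Sum>j\<le>k. \<beta> j * \<beta> (k - j)) + (\<Sum>j\<le>k - 1. \<beta> j * \<beta> (k - 1 - j)) - (p + 1) * \<beta> k)"
    using nth[of k] \<open>k \<ge> 1\<close> by (simp add: AA A_nth z_def add_ac del: of_real_sum)
  thus "x * ((real k + 1) * \<beta> (Suc k)) + real k * \<beta> k =
      x * (\<Sum>j\<le>k. \<beta> j * \<beta> (k - j)) + (\<Sum>j\<le>k - 1. \<beta> j * \<beta> (k - 1 - j)) - (p + 1) * \<beta> k"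
    by (simp only: of_real_eq_iff)
qed

text \<open>Consecutive orders share no zero, so \<open>D p\<close> is regular at the chosen
  point.\<close>

lemma bes_at_bessel_zero:
  assumes "p > 0" "n \<ge> 1"
  defines "x \<equiv> (bessel_zero (p - 1) n)\<^sup>2"
  shows "x > 0" "bes (p - 1) x = 0" "bes p x \<noteq> 0"
proof -
  obtain m where "n = Suc m" using assms by (cases n) auto
  hence "bessel_zero (p - 1) n \<in> {z. 0 < z \<and> bessel_J (p - 1) z = 0}"
    using bessel_zero_enumerates(2)[of "p - 1"] assms(1) by auto
  thus "x > 0" and 0: "bes (p - 1) x = 0"
    using assms(1) by (auto simp: x_def bessel_J_zero_iff)
  show "bes p x \<noteq> 0"
    using bes_simple_zero[of "p - 1" "of_real x"] 0 assms(1) by (simp add: bes_of_real)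
qed

lemma gamma_minus_eq_F:
  assumes "k \<ge> 1" "p > 0" "n \<ge> 1"
  shows "gamma_minus p n k = eval_py (F k) p ((bessel_zero (p - 1) n)\<^sup>2)"
proof -
  define x where "x = (bessel_zero (p - 1) n)\<^sup>2"
  note x = bes_at_bessel_zero[OF assms(2,3), folded x_def]
  have p: "p > -1" using assms by simp
  \<comment> \<open>The recurrence for order p - 1, whose own term vanishes at \<open>x\<close>,
    yields the initial value \<open>D p x = p / x\<close>.\<close>
  have "x * bes (p + 1) x = 4 * (p * bes p x)"
    using bes_recurrence[of "p - 1" x] assms x(2) by (simp add: add.commute)
  hence "D p x = p / x"
    using x p by (simp add: D_eq_bes_logderiv bes_logderiv_def field_simps)
  thus ?thesis unfolding gamma_minus_def beta_minus_def x_def[symmetric]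
    using riccati_coefficients_eq_F[of x "\<lambda>k. (deriv ^^ k) (D p) x / fact k" p k]
      bes_riccati_taylor[OF p x(1,3)] x assms by simp
qed

text \<open>The general expansion applied to \<open>bes p\<close>, whose complex zeros are exactly
  the squares of the positive Bessel zeros. The minus sign there cancels against
  \<open>bes_logderiv\<close>.\<close>

lemma bes_partial_fractions:
  assumes p: "p > -1" and x: "x > 0" "bes p x \<noteq> 0" and "k \<ge> 1"
  shows "(\<lambda>m. 1 / ((bessel_zero p (Suc m))\<^sup>2 - x) ^ Suc k) sums ((deriv ^^ k) (D p) x / fact k)"
proof -
  define b where "b = (\<lambda>m. bessel_zero p (Suc m))"
  define a where "a = (\<lambda>m. of_real ((b m)\<^sup>2) :: complex)"
  note enum = bessel_zero_enumerates[OF p, folded b_def]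
  have b: "0 < b m" "bes p ((b m)\<^sup>2) = 0" for m
    using enum(2) p bessel_J_zero_iff[OF p, of "b m"] by (auto simp: set_eq_iff)
  have norm_a: "norm (a m) = (b m)\<^sup>2" for m by (simp add: a_def norm_power)
  have zeros: "{z. bes p z = 0} = range a"
  proof (intro equalityI subsetI)
    fix z :: complex assume z: "z \<in> {z. bes p z = 0}"
    define t where "t = Re z"
    have zt: "z = of_real t" using bes_zero_real[OF p, of z] z by (simp add: t_def complex_eq_iff)
    hence t0: "bes p t = 0" using z p by (simp add: bes_of_real)
    hence "t > 0" using bes_pos[OF p, of t] by fastforce
    hence "sqrt t \<in> range b" unfolding enum(2) using t0 p by (simp add: bessel_J_zero_iff)
    then obtain m where "sqrt t = b m" by blast
    hence "t = (b m)\<^sup>2" using \<open>t > 0\<close> by (metis less_imp_le real_sqrt_pow2)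
    thus "z \<in> range a" using zt by (auto simp: a_def)
  qed (use b p in \<open>auto simp: a_def bes_of_real simp del: of_real_power\<close>)
  have mono_sq: "(b m)\<^sup>2 < (b n)\<^sup>2" if "m < n" for m n
    using enum(1) b(1)[of m] that by (intro power_strict_mono) (auto simp: strict_mono_def)
  have "inj a"
    by (rule inj_onI) (metis a_def mono_sq less_irrefl linorder_neqE_nat of_real_eq_iff)
  have logd: "(\<lambda>z. deriv (bes p) z / bes p z) = (\<lambda>z :: complex. - bes_logderiv p z)"
    by (simp add: deriv_bes[OF p] bes_logderiv_def fun_eq_iff)
  have bx: "bes p (of_real x :: complex) \<noteq> 0" using x p by (simp add: bes_of_real)
  have "(\<lambda>m. 1 / (a m - of_real x) ^ Suc k) sums
      (- (deriv ^^ k) (\<lambda>z. deriv (bes p) z / bes p z) (of_real x) / fact k)"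
  proof (rule partial_fractions_of_logderiv[OF holomorphic_on_bes[OF p] bes_0_nonzero[OF p] zeros \<open>inj a\<close> _ _ _ norm_bes_le[OF p] _ bx \<open>k \<ge> 1\<close>])
    show "deriv (bes p) (a m) \<noteq> 0" for m
      using deriv_bes[OF p, of "a m"] bes_simple_zero[OF p, of "a m"] zeros by auto
    show "incseq (\<lambda>m. norm (a m))"
      unfolding norm_a by (rule incseq_SucI) (use mono_sq in \<open>auto intro: less_imp_le\<close>)
    show "filterlim (\<lambda>m. norm (a m)) at_top sequentially"
      unfolding norm_a by (rule filterlim_compose[OF filterlim_pow_at_top[OF _ filterlim_ident] enum(3)]) simp
  qed simp
  also have "- (deriv ^^ k) (\<lambda>z. deriv (bes p) z / bes p z) (of_real x) / fact k
      = (of_real ((deriv ^^ k) (D p) x / fact k) :: complex)"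
    unfolding logd
    using higher_deriv_uminus[OF bes_logderiv_holomorphic[OF p] open_bes_nonzero[OF p], of "of_real x" k] bx
      higher_deriv_D[OF p x] by simp
  also have "(\<lambda>m. 1 / (a m - of_real x) ^ Suc k) = (\<lambda>m. of_real (1 / ((b m)\<^sup>2 - x) ^ Suc k))"
    by (simp add: a_def)
  finally show ?thesis unfolding b_def by (simp only: sums_of_real_iff)
qed

theorem theorem3:
  "(\<forall>k::nat. \<forall>p::real. \<forall>n::nat. k \<ge> 1 \<longrightarrow> p > 0 \<longrightarrow> n \<ge> 1 \<longrightarrow>
      gamma_minus p n k = eval_py (F k) p ((bessel_zero (p - 1) n)\<^sup>2))
   \<and> (\<forall>k::nat. k \<ge> 1 \<longrightarrow>
      degree (F k) = 1 + (k - 1) div 2 \<and>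
      degree (F k) = (k + 1) div 2 \<and>
      degree_p (F k) = max 1 (k - 1))
   \<and> (\<forall>r::nat. \<forall>p::real. \<forall>n::nat. r \<ge> 2 \<longrightarrow> p > 0 \<longrightarrow> n \<ge> 1 \<longrightarrow>
      summable (\<lambda>m. 1 / ((bessel_zero p (Suc m))\<^sup>2 - (bessel_zero (p - 1) n)\<^sup>2) ^ r) \<and>
      T_minus r p n =
        eval_py (F (r - 1)) p ((bessel_zero (p - 1) n)\<^sup>2) / ((bessel_zero (p - 1) n)\<^sup>2) ^ r)
   \<and> (\<forall>r::nat. r \<ge> 2 \<longrightarrow>
      degree (F (r - 1)) = r div 2 \<and>
      degree_p (F (r - 1)) = max 1 (r - 2) \<and>
      degree (pcompose (F (r - 1)) (indet_y\<^sup>2)) = 2 * (r div 2) \<and>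
      2 * (r div 2) = (if even r then r else r - 1))"
proof (intro conjI allI impI)
  fix r :: nat assume r: "r \<ge> 2"
  then obtain k where k: "r = Suc k" "k \<ge> 1" by (cases r) auto
  have half: "1 + (k - 1) div 2 = Suc k div 2" using k(2) by (cases k) auto
  show "degree (F (r - 1)) = r div 2" using degree_F[OF k(2)] half k by simp
  show "degree_p (F (r - 1)) = max 1 (r - 2)" using degree_p_F[OF k(2)] k by simp
  show "degree (pcompose (F (r - 1)) (indet_y\<^sup>2)) = 2 * (r div 2)"
    using degree_F[OF k(2)] half k by (simp add: degree_pcompose degree_power_eq)
  show "2 * (r div 2) = (if even r then r else r - 1)" by (auto elim: oddE)
  fix p :: real and n :: nat assume p: "p > 0" and n: "n \<ge> 1"
  define x where "x = (bessel_zero (p - 1) n)\<^sup>2"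
  note x = bes_at_bessel_zero[OF p n, folded x_def]
  \<comment> \<open>Power sum number \<open>r\<close> is Taylor coefficient number
    \<open>k = r - 1\<close>; \<open>r \<ge> 2\<close> is what makes the expansion with
    \<open>k \<ge> 1\<close> available.\<close>
  have sums: "(\<lambda>m. 1 / ((bessel_zero p (Suc m))\<^sup>2 - x) ^ r) sums beta_minus p n k"
    unfolding k(1) beta_minus_def x_def[symmetric]
    using bes_partial_fractions[OF _ x(1,3) k(2)] p by simp
  show "summable (\<lambda>m. 1 / ((bessel_zero p (Suc m))\<^sup>2 - (bessel_zero (p - 1) n)\<^sup>2) ^ r)"
    using sums unfolding x_def by (rule sums_summable)
  have "T_minus r p n = beta_minus p n k"
    using sums unfolding T_minus_def x_def by (rule sums_unique[symmetric])
  also have "\<dots> = gamma_minus p n k / x ^ r"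
    using x(1) k(1) by (simp add: gamma_minus_def x_def[symmetric])
  finally show "T_minus r p n = eval_py (F (r - 1)) p ((bessel_zero (p - 1) n)\<^sup>2) / ((bessel_zero (p - 1) n)\<^sup>2) ^ r"
    using gamma_minus_eq_F[OF k(2) p n] k(1) by (simp add: x_def)
next
  fix k :: nat assume "k \<ge> 1"
  thus "degree (F k) = 1 + (k - 1) div 2" "degree (F k) = (k + 1) div 2" "degree_p (F k) = max 1 (k - 1)"
    using degree_F[of k] degree_p_F[of k] by (cases k; simp)+
qed (rule gamma_minus_eq_F)

end
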